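(* Let $K$ be a $J$-Hermitian kernel on $\mathbb{R}$ satisfying the following. (1) $K$ is the integral kernel of a bounded linear operator (also denoted $K$) on $L^2(\mathbb{R})$ such that $P_+KP_+$ and $P_-KP_-$ are non-negative; for all bounded subsets $\Delta_1\subset\mathbb{R}_+$, $\Delta_2\subset\mathbb{R}_-$, the operators $\chi_{\Delta_i}K\chi_{\Delta_i}$ ($i=1,2$) are trace-class and $\chi_{\Delta_2}K\chi_{\Delta_1}$ is Hilbert–Schmidt; and $\widehat K:=\mathrm{sgn}\cdot K+\chi_{\mathbb{R}_-}$ is an orthogonal projection on $L^2(\mathbb{R},dx)$. (2) For every $R>0$, $\int_{|x|\le R}K(x,x)\,dx<\infty$; and for some fixed $M>0$ there is a non-negative $\Phi\in L^1(\mathbb{R},dt)$ with $\int_{|t|\ge R}\Phi(t)\,dt=O(R^{-1})$ as $R\to\infty$ such that $|K(x,y)|^2\le\Phi(x-y)$ whenever $|x|\ge M$ and $|y|\ge M$. Let $n,k$ be two non-negative integers with $n\ne k$. Then for $\rho_{n+k}$-almost every $\mathfrak{p}=(p_1^+,\dots,p_n^+;p_1^-,\dots,p_k^-)\in\mathbb{R}_+^n\times\mathbb{R}_-^k$ of distinct points (equivalently, for Lebesgue-almost every such $\mathfrak{p}$ at which the density of the correlation measure $\rho_{n+k}$ of $\mathbb{P}_K$ is positive), the reduced Palm measure $\mathbb{P}_K^{\mathfrak{p}}$ and $\mathbb{P}_K$ are mutually singular.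
   Context: $\mathbb{R}_+$, $\mathbb{R}_-$ are the open positive and negative semi-axes, $\mathbb{R}^*=\mathbb{R}_+\sqcup\mathbb{R}_-$; $P_\pm$ are the orthogonal projections of $L^2(\mathbb{R})$ onto $L^2(\mathbb{R}_\pm)$; bounded functions are identified with multiplication operators. A kernel $K$ is $J$-Hermitian if it induces a bounded operator on $L^2(\mathbb{R})$ and $K(x,y)=\mathrm{sgn}(x)\mathrm{sgn}(y)\overline{K(y,x)}$ for $x,y\in\mathbb{R}^*$. $\mathrm{Conf}(\mathbb{R})$ is the set of locally finite subsets of $\mathbb{R}$ with the Borel structure generated by the maps $X\mapsto\#(X\cap B)$, $B$ bounded Borel. A probability measure on $\mathrm{Conf}(\mathbb{R})$ is determinantal with correlation kernel $K$ if for all $k\ge1$ its $k$-th correlation measure is $\rho_k(dx_1\cdots dx_k)=\det(K(x_i,x_j))_{1\le i,j\le k}\,dx_1\cdots dx_k$, where $\rho_k$ is characterized by $\mathbb{E}\prod_{i=1}^k\#(X\cap D_i)=\rho_k(D_1\times\cdots\times D_k)$ for disjoint bounded Borel $D_i$. By a theorem of Lytvynov, a kernel $K$ satisfying (1) is the correlation kernel of a determinantal point process on $\mathbb{R}$, denoted $\mathbb{P}_K$ (as usual the integral kernel is chosen so that its diagonal values $K(x,x)$ give the local traces). Reduced Palm measures. For a point process $\mathbb{P}$ with correlation measures $\rho_k$, the reduced Palm measures $\mathbb{P}^{\mathfrak{q}}$, defined for $\rho_k$-almost every $k$-tuple $\mathfrak{q}=(q_1,\dots,q_k)$ of distinct points,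 are point processes determined by $$\int\sum^{*}_{q_1,\dots,q_k\in X}u(X;\mathfrak{q})\,\mathbb{P}(dX)=\int\rho_k(d\mathfrak{q})\int u(X\cup\{q_1,\dots,q_k\};\mathfrak{q})\,\mathbb{P}^{\mathfrak{q}}(dX)$$ for all non-negative Borel $u$, where $\sum^*$ is over $k$-tuples of distinct points of $X$. *)

theory Defs
  imports "HOL-Probability.Probability" "Jordan_Normal_Form.Determinant"
begin

section \<open>Operators on $L^2(\mathbf{R})$\<close>

text \<open>
  Elements of the complex Hilbert space $L^2(\mathbf{R},dx)$ are represented by Borel functions, so
  that equality of vectors is equality almost everywhere.  An operator is a map on representatives;
  boundedness forces it to respect equality almost everywhere.
\<close>

type_synonym l2_op = "(real \<Rightarrow> complex) \<Rightarrow> (real \<Rightarrow> complex)"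

definition L2 :: "(real \<Rightarrow> complex) set" where
  "L2 = {f \<in> borel_measurable lborel. integrable lborel (\<lambda>x. (cmod (f x))\<^sup>2)}"

definition l2_inner :: "(real \<Rightarrow> complex) \<Rightarrow> (real \<Rightarrow> complex) \<Rightarrow> complex" where
  "l2_inner f g = (LINT x|lborel. cnj (f x) * g x)"

definition l2_norm :: "(real \<Rightarrow> complex) \<Rightarrow> real" where
  "l2_norm f = sqrt (LINT x|lborel. (cmod (f x))\<^sup>2)"

definition bounded_op :: "l2_op \<Rightarrow> bool" where
  "bounded_op T \<longleftrightarrow>
     (\<forall>f\<in>L2. T f \<in> L2) \<and>
     (\<forall>f\<in>L2. \<forall>g\<in>L2. \<forall>a b. AE x in lborel. T (\<lambda>x. a * f x + b * g x) x = a * T f x + b * T g x) \<and>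
     (\<exists>C. \<forall>f\<in>L2. l2_norm (T f) \<le> C * l2_norm f)"

definition nonneg_op :: "l2_op \<Rightarrow> bool" where
  "nonneg_op T \<longleftrightarrow> (\<forall>f\<in>L2. l2_inner f (T f) \<in> \<real>\<^sub>\<ge>\<^sub>0)"

definition orthogonal_projection :: "l2_op \<Rightarrow> bool" where
  "orthogonal_projection T \<longleftrightarrow>
     bounded_op T \<and>
     (\<forall>f\<in>L2. AE x in lborel. T (T f) x = T f x) \<and>
     (\<forall>f\<in>L2. \<forall>g\<in>L2. l2_inner (T f) g = l2_inner f (T g))"

definition orthonormal_basis :: "(nat \<Rightarrow> real \<Rightarrow> complex) \<Rightarrow> bool" where
  "orthonormal_basis e \<longleftrightarrow>
     (\<forall>m. e m \<in> L2) \<and>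
     (\<forall>m n. l2_inner (e m) (e n) = (if m = n then 1 else 0)) \<and>
     (\<forall>f\<in>L2. (\<forall>m. l2_inner (e m) f = 0) \<longrightarrow> (AE x in lborel. f x = 0))"

text \<open>
  \<open>S\<close> is the absolute value of \<open>T\<close>: the bounded non-negative (hence self-adjoint) operator
  whose square is the product of the adjoint of \<open>T\<close> with \<open>T\<close>.  The identity of the squares is
  written through inner products.
\<close>

definition is_abs_op :: "l2_op \<Rightarrow> l2_op \<Rightarrow> bool" where
  "is_abs_op T S \<longleftrightarrow>
     bounded_op S \<and> nonneg_op S \<and>
     (\<forall>f\<in>L2. \<forall>g\<in>L2. l2_inner (S f) (S g) = l2_inner (T f) (T g))"

definition trace_class :: "l2_op \<Rightarrow> bool" where
  "trace_class T \<longleftrightarrow>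
     bounded_op T \<and>
     (\<exists>S e. is_abs_op T S \<and> orthonormal_basis e \<and> summable (\<lambda>m. l2_inner (e m) (S (e m))))"

definition has_trace :: "l2_op \<Rightarrow> complex \<Rightarrow> bool" where
  "has_trace T t \<longleftrightarrow>
     trace_class T \<and> (\<forall>e. orthonormal_basis e \<longrightarrow> (\<lambda>m. l2_inner (e m) (T (e m))) sums t)"

definition hilbert_schmidt :: "l2_op \<Rightarrow> bool" where
  "hilbert_schmidt T \<longleftrightarrow>
     bounded_op T \<and> (\<exists>e. orthonormal_basis e \<and> summable (\<lambda>m. (l2_norm (T (e m)))\<^sup>2))"

definition mult_op :: "(real \<Rightarrow> complex) \<Rightarrow> l2_op" where
  "mult_op g f = (\<lambda>x. g x * f x)"

text \<open>
  The indicator \<open>chi D\<close> as a multiplication operator.  In particular \<open>chi {0<..}\<close> and \<open>chi {..<0}\<close>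
  are the projections onto the functions supported on the two half-lines.
\<close>

definition chi :: "real set \<Rightarrow> l2_op" where
  "chi D = mult_op (indicator D)"


section \<open>Kernels\<close>

definition integral_op :: "(real \<Rightarrow> real \<Rightarrow> complex) \<Rightarrow> l2_op" where
  "integral_op K f = (\<lambda>x. LINT y|lborel. K x y * f y)"

definition bounded_kernel :: "(real \<Rightarrow> real \<Rightarrow> complex) \<Rightarrow> bool" where
  "bounded_kernel K \<longleftrightarrow>
     case_prod K \<in> borel_measurable borel \<and>
     (\<forall>f\<in>L2. AE x in lborel. integrable lborel (\<lambda>y. K x y * f y)) \<and>
     bounded_op (integral_op K)"

definition J_hermitian :: "(real \<Rightarrow> real \<Rightarrow> complex) \<Rightarrow> bool" where
  "J_hermitian K \<longleftrightarrow>
     bounded_kernel K \<and>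
     (\<forall>x y. x \<noteq> 0 \<longrightarrow> y \<noteq> 0 \<longrightarrow> K x y = of_real (sgn x) * of_real (sgn y) * cnj (K y x))"

definition K_hat :: "(real \<Rightarrow> real \<Rightarrow> complex) \<Rightarrow> l2_op" where
  "K_hat K f = (\<lambda>x. mult_op (\<lambda>t. of_real (sgn t)) (integral_op K f) x + chi {..<0} f x)"

definition lytvynov_condition :: "(real \<Rightarrow> real \<Rightarrow> complex) \<Rightarrow> bool" where
  "lytvynov_condition K \<longleftrightarrow>
     bounded_kernel K \<and>
     nonneg_op (chi {0<..} \<circ> integral_op K \<circ> chi {0<..}) \<and>
     nonneg_op (chi {..<0} \<circ> integral_op K \<circ> chi {..<0}) \<and>
     (\<forall>D1 D2. D1 \<in> sets borel \<longrightarrow> bounded D1 \<longrightarrow> D1 \<subseteq> {0<..} \<longrightarrow>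
              D2 \<in> sets borel \<longrightarrow> bounded D2 \<longrightarrow> D2 \<subseteq> {..<0} \<longrightarrow>
        trace_class (chi D1 \<circ> integral_op K \<circ> chi D1) \<and>
        trace_class (chi D2 \<circ> integral_op K \<circ> chi D2) \<and>
        hilbert_schmidt (chi D2 \<circ> integral_op K \<circ> chi D1)) \<and>
     orthogonal_projection (K_hat K)"

text \<open>
  A kernel is determined by its operator only up to null sets, which leaves the diagonal
  undetermined.  The usual normalization is that the diagonal gives the local traces.
\<close>

definition diagonal_gives_traces :: "(real \<Rightarrow> real \<Rightarrow> complex) \<Rightarrow> bool" where
  "diagonal_gives_traces K \<longleftrightarrow>
     (\<forall>D. D \<in> sets borel \<longrightarrow> bounded D \<longrightarrow> D \<subseteq> {0<..} \<or> D \<subseteq> {..<0} \<longrightarrow>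
        set_integrable lborel D (\<lambda>x. K x x) \<and>
        has_trace (chi D \<circ> integral_op K \<circ> chi D) (LINT x:D|lborel. K x x))"

definition decay_condition :: "(real \<Rightarrow> real \<Rightarrow> complex) \<Rightarrow> bool" where
  "decay_condition K \<longleftrightarrow>
     (\<forall>R>0. set_integrable lborel {x. \<bar>x\<bar> \<le> R} (\<lambda>x. K x x)) \<and>
     (\<exists>M>0. \<exists>\<Phi> :: real \<Rightarrow> real.
        (\<forall>t. 0 \<le> \<Phi> t) \<and> integrable lborel \<Phi> \<and>
        (\<lambda>R. LINT t:{t. R \<le> \<bar>t\<bar>}|lborel. \<Phi> t) \<in> O[at_top](\<lambda>R. 1 / R) \<and>
        (\<forall>x y. M \<le> \<bar>x\<bar> \<longrightarrow> M \<le> \<bar>y\<bar> \<longrightarrow> (cmod (K x y))\<^sup>2 \<le> \<Phi> (x - y)))"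


section \<open>Point processes\<close>

definition Conf :: "real set set" where
  "Conf = {X. \<forall>B. bounded B \<longrightarrow> finite (X \<inter> B)}"

definition conf_space :: "real set measure" where
  "conf_space = sigma Conf {{X \<in> Conf. card (X \<inter> B) = m} | B m. B \<in> sets borel \<and> bounded B}"

definition point_process :: "real set measure \<Rightarrow> bool" where
  "point_process P \<longleftrightarrow> prob_space P \<and> sets P = sets conf_space"

text \<open>
  Tuples of length \<open>m\<close> are functions on \<open>{..<m}\<close>, in the sense of the product measure \<open>PiM\<close>.
  The identity on products of disjoint sets only determines a correlation measure away from
  the diagonals; the convention is that the diagonals are null.
\<close>

definition correlation_measure :: "real set measure \<Rightarrow> nat \<Rightarrow> (nat \<Rightarrow> real) measure \<Rightarrow> bool" where
  "correlation_measure P m \<rho> \<longleftrightarrow>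
     sets \<rho> = sets (PiM {..<m} (\<lambda>_. borel)) \<and>
     (AE q in \<rho>. inj_on q {..<m}) \<and>
     (\<forall>D. (\<forall>i<m. D i \<in> sets borel \<and> bounded (D i)) \<longrightarrow> disjoint_family_on D {..<m} \<longrightarrow>
        (\<integral>\<^sup>+X. (\<Prod>i<m. of_nat (card (X \<inter> D i))) \<partial>P) = emeasure \<rho> (PiE {..<m} D))"

definition kernel_det :: "(real \<Rightarrow> real \<Rightarrow> complex) \<Rightarrow> nat \<Rightarrow> (nat \<Rightarrow> real) \<Rightarrow> complex" where
  "kernel_det K m q = Determinant.det (Matrix.mat m m (\<lambda>(i, j). K (q i) (q j)))"

definition det_measure :: "(real \<Rightarrow> real \<Rightarrow> complex) \<Rightarrow> nat \<Rightarrow> (nat \<Rightarrow> real) measure" where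
  "det_measure K m = density (PiM {..<m} (\<lambda>_. lborel)) (\<lambda>q. ennreal (Re (kernel_det K m q)))"

text \<open>
  The condition that the determinants are non-negative reals almost everywhere makes
  \<open>det_measure K m\<close> the measure whose density is the determinant itself, rather than
  the positive part of its real part.
\<close>

definition determinantal :: "(real \<Rightarrow> real \<Rightarrow> complex) \<Rightarrow> real set measure \<Rightarrow> bool" where
  "determinantal K P \<longleftrightarrow>
     point_process P \<and>
     (\<forall>m\<ge>1. (AE q in PiM {..<m} (\<lambda>_. lborel). kernel_det K m q \<in> \<real>\<^sub>\<ge>\<^sub>0) \<and>
             correlation_measure P m (det_measure K m))"

definition distinct_tuples :: "nat \<Rightarrow> real set \<Rightarrow> (nat \<Rightarrow> real) set" where
  "distinct_tuples m X = {q \<in> {..<m} \<rightarrow>\<^sub>E X. inj_on q {..<m}}"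

text \<open>
  \<open>Q\<close> is a version of the family of reduced Palm measures of \<open>P\<close>, where \<open>\<rho>\<close> is the
  \<open>m\<close>-th correlation measure of \<open>P\<close>.  Since the family matters only almost everywhere, it is
  taken to be defined at every tuple.  The second conjunct says that the points of \<open>q\<close> have been
  removed; the integral identity alone cannot express this, because its right-hand side depends on
  the configuration \<open>X\<close> only through \<open>X \<union> q ` {..<m}\<close>.
\<close>

definition reduced_palm ::
    "real set measure \<Rightarrow> nat \<Rightarrow> (nat \<Rightarrow> real) measure \<Rightarrow> ((nat \<Rightarrow> real) \<Rightarrow> real set measure) \<Rightarrow> bool" where
  "reduced_palm P m \<rho> Q \<longleftrightarrow>
     Q \<in> measurable \<rho> (prob_algebra conf_space) \<and>
     (AE q in \<rho>. AE X in Q q. X \<inter> q ` {..<m} = {}) \<and>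
     (\<forall>u :: real set \<times> (nat \<Rightarrow> real) \<Rightarrow> ennreal.
        u \<in> borel_measurable (conf_space \<Otimes>\<^sub>M PiM {..<m} (\<lambda>_. borel)) \<longrightarrow>
        (\<integral>\<^sup>+X. (\<integral>\<^sup>+q. u (X, q) \<partial>count_space (distinct_tuples m X)) \<partial>P) =
        (\<integral>\<^sup>+q. (\<integral>\<^sup>+X. u (X \<union> q ` {..<m}, q) \<partial>Q q) \<partial>\<rho>))"

definition mutually_singular :: "'a measure \<Rightarrow> 'a measure \<Rightarrow> bool" where
  "mutually_singular \<mu> \<nu> \<longleftrightarrow>
     sets \<mu> = sets \<nu> \<and>
     (\<exists>A\<in>sets \<mu>. emeasure \<mu> A = 0 \<and> emeasure \<nu> (space \<nu> - A) = 0)"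

end

theory Submission
  imports Defs
begin

text \<open>
  Give a point \<open>x\<close> of a configuration the charge \<open>sgn x\<close>.  The total charge of the process is
  rigid: there are finitely supported cutoffs \<open>f\<^sub>j\<close> tending to 1 pointwise for which the centred
  charge \<open>Z\<^sub>j(X) = (\<Sum>x\<in>X. f\<^sub>j(x) sgn x) - c\<^sub>j\<close>, with \<open>c\<^sub>j\<close> the mean, tends to 0
  for \<open>P\<close>-almost every \<open>X\<close>.  Inserting
  \<open>n\<close> positive and \<open>k\<close> negative points raises the limit by \<open>n - k\<close>.  The Palm identity,
  applied to the event that \<open>Z\<^sub>j\<close> does not tend to 0, says that \<open>X \<union> p\<close> has the almost sure
  behaviour of \<open>P\<close> when \<open>X\<close> is drawn from the reduced Palm measure; hence \<open>Z\<^sub>j(X)\<close> tends to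
  \<open>k - n\<close> there, and for \<open>n \<noteq> k\<close> the event \<open>Z\<^sub>j \<longlongrightarrow> 0\<close> separates the two measures.

  The rigidity is a variance computation.  By the \<open>J\<close>-Hermitian symmetry,
  \<open>K(x,y) K(y,x) = sgn x sgn y \<bar>K(x,y)\<bar>\<^sup>2\<close>, so the variance of the charge weighted by \<open>f\<close> is
  \<open>\<integral> f(x)\<^sup>2 K(x,x) - \<integral>\<integral> f(x) f(y) \<bar>K(x,y)\<bar>\<^sup>2\<close>.  Since \<open>K_hat\<close> is a projection and the diagonal
  gives the traces, \<open>K(x,x) = \<integral> \<bar>K(x,y)\<bar>\<^sup>2 dy\<close> on average over
  bounded subsets of a half-line
  (\<open>trace_eq_Hilbert_Schmidt_norm\<close>, which rests on Parseval's identity), and the variance becomes the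
  Dirichlet form \<open>1/2 \<integral>\<integral> (f(x) - f(y))\<^sup>2 \<bar>K(x,y)\<bar>\<^sup>2\<close>.  The decay of \<open>K\<close> bounds this form on
  tent functions of width \<open>R\<close>, uniformly in \<open>R\<close> (\<open>form_tent_le\<close>).  Moreover a wide tent is nearly
  orthogonal to any fixed finitely supported function, because it is nearly constant on the region that
  such a function sees (\<open>tendsto_form_tent\<close>).  Averages of \<open>N\<close> successively wider tents therefore
  have a form of order \<open>1/N\<close> (\<open>cheap_cutoffs\<close>), and summable
  variances give the almost sure limit.

  All cutoffs are constant on the unit cells \<open>[i, i + 1)\<close>.  Only the numbers of points in the cells
  then matter, and the continuous Dirichlet form becomes a quadratic form on functions of an integer
  with weights \<open>\<integral>\<integral> \<bar>K(x,y)\<bar>\<^sup>2\<close> over products of two cells.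
\<close>

section \<open>Orthonormal expansions in $L^2(\mathbf{R})$\<close>

lemma L2_measurable [measurable_dest]: "f \<in> L2 \<Longrightarrow> f \<in> borel_measurable borel"
  by (simp add: L2_def)

lemma L2_integrable_square: "f \<in> L2 \<Longrightarrow> integrable lborel (\<lambda>x. (cmod (f x))\<^sup>2)"
  by (simp add: L2_def)

lemma L2_iff_nn_integral:
  "f \<in> L2 \<longleftrightarrow> f \<in> borel_measurable borel \<and> (\<integral>\<^sup>+x. ennreal ((cmod (f x))\<^sup>2) \<partial>lborel) < \<infinity>"
  by (auto simp: L2_def integrable_iff_bounded)

lemma L2_integrable_product:
  assumes "f \<in> L2" "g \<in> L2"
  shows "integrable lborel (\<lambda>x. cnj (f x) * g x)"
proof (rule Bochner_Integration.integrable_bound)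
  show "integrable lborel (\<lambda>x. (cmod (f x))\<^sup>2 + (cmod (g x))\<^sup>2)"
    using assms by (intro Bochner_Integration.integrable_add L2_integrable_square)
  have [measurable]: "f \<in> borel_measurable borel" "g \<in> borel_measurable borel"
    using assms by (auto dest: L2_measurable)
  have [measurable]: "(\<lambda>x. cnj (f x)) \<in> borel_measurable borel"
    by (rule borel_measurable_continuous_on[OF _ \<open>f \<in> borel_measurable borel\<close>]) (intro continuous_intros)
  show "(\<lambda>x. cnj (f x) * g x) \<in> borel_measurable lborel"
    by measurable
  have "a * b \<le> a\<^sup>2 + b\<^sup>2" if "0 \<le> a" "0 \<le> b" for a b :: real
  proof -
    have "2 * (a * b) \<le> a\<^sup>2 + b\<^sup>2" using sum_squares_bound[of a b] by (simp add: mult.assoc)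
    with that show ?thesis by (smt (verit) mult_nonneg_nonneg)
  qed
  then show "AE x in lborel. norm (cnj (f x) * g x) \<le> norm ((cmod (f x))\<^sup>2 + (cmod (g x))\<^sup>2)"
    by (auto simp: norm_mult)
qed

lemma L2_combine:
  assumes "f \<in> L2" "g \<in> L2"
  shows "(\<lambda>x. a * f x + b * g x) \<in> L2"
proof -
  have [measurable]: "f \<in> borel_measurable borel" "g \<in> borel_measurable borel"
    using assms by (auto dest: L2_measurable)
  have "(cmod (a * f x + b * g x))\<^sup>2 \<le> 2 * (cmod a)\<^sup>2 * (cmod (f x))\<^sup>2 + 2 * (cmod b)\<^sup>2 * (cmod (g x))\<^sup>2" for x
  proof -
    have "(cmod (a * f x + b * g x))\<^sup>2 \<le> (cmod (a * f x) + cmod (b * g x))\<^sup>2"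
      by (intro power_mono norm_triangle_ineq) auto
    also have "\<dots> \<le> 2 * (cmod (a * f x))\<^sup>2 + 2 * (cmod (b * g x))\<^sup>2"
      using sum_squares_bound[of "cmod (a * f x)" "cmod (b * g x)"] unfolding power2_sum by linarith
    finally show ?thesis by (simp add: norm_mult power_mult_distrib mult.assoc)
  qed
  then have "integrable lborel (\<lambda>x. (cmod (a * f x + b * g x))\<^sup>2)"
    using assms
    by (intro Bochner_Integration.integrable_bound[OF
          Bochner_Integration.integrable_add[OF
            integrable_mult_right[OF L2_integrable_square[OF assms(1)], of "2 * (cmod a)\<^sup>2"]
            integrable_mult_right[OF L2_integrable_square[OF assms(2)], of "2 * (cmod b)\<^sup>2"]]])
       (auto simp: abs_of_nonneg)
  then show ?thesis by (simp add: L2_def)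
qed

lemma L2_zero: "(\<lambda>x. 0) \<in> L2"
  by (simp add: L2_def)

lemma L2_diff: "f \<in> L2 \<Longrightarrow> g \<in> L2 \<Longrightarrow> (\<lambda>x. f x - g x) \<in> L2"
  using L2_combine[of f g 1 "-1"] by simp

lemma L2_sum_smult:
  assumes "\<And>m. m \<in> A \<Longrightarrow> e m \<in> L2"
  shows "(\<lambda>x. \<Sum>m\<in>A. c m * e m x) \<in> L2"
proof (cases "finite A")
  case True
  then show ?thesis using assms
  proof (induction A)
    case (insert a A)
    then show ?case using L2_combine[of "e a" "\<lambda>x. \<Sum>m\<in>A. c m * e m x" "c a" 1] by simp
  qed (simp add: L2_zero)
qed (simp add: L2_zero)

lemma l2_inner_cnj:
  "cnj (l2_inner f g) = l2_inner g f"
proof -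
  have "cnj (l2_inner f g) = (LINT x|lborel. cnj (cnj (f x) * g x))"
    unfolding l2_inner_def by (rule Bochner_Integration.integral_cnj[symmetric])
  then show ?thesis by (simp add: l2_inner_def mult.commute)
qed

lemma l2_inner_diff_right:
  assumes "f \<in> L2" "g \<in> L2" "h \<in> L2"
  shows "l2_inner f (\<lambda>x. g x - h x) = l2_inner f g - l2_inner f h"
  unfolding l2_inner_def using assms
  by (simp add: right_diff_distrib L2_integrable_product)

lemma l2_inner_sum_right:
  assumes "f \<in> L2" "\<And>m. m \<in> A \<Longrightarrow> e m \<in> L2"
  shows "l2_inner f (\<lambda>x. \<Sum>m\<in>A. c m * e m x) = (\<Sum>m\<in>A. c m * l2_inner f (e m))"
proof -
  have *: "integrable lborel (\<lambda>x. c m * (cnj (f x) * e m x))" if "m \<in> A" for m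
    using that assms by (intro integrable_mult_right L2_integrable_product) auto
  have "l2_inner f (\<lambda>x. \<Sum>m\<in>A. c m * e m x) = (LINT x|lborel. (\<Sum>m\<in>A. c m * (cnj (f x) * e m x)))"
    unfolding l2_inner_def by (intro Bochner_Integration.integral_cong) (auto simp: sum_distrib_left mult_ac)
  also have "\<dots> = (\<Sum>m\<in>A. LINT x|lborel. c m * (cnj (f x) * e m x))"
    by (rule Bochner_Integration.integral_sum) (rule *)
  finally show ?thesis by (simp add: l2_inner_def)
qed

lemma l2_norm_square: "(l2_norm f)\<^sup>2 = (LINT x|lborel. (cmod (f x))\<^sup>2)"
  unfolding l2_norm_def by (simp add: Bochner_Integration.integral_nonneg)

lemma l2_inner_self: "l2_inner f f = complex_of_real ((l2_norm f)\<^sup>2)"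
  unfolding l2_norm_square l2_inner_def
  by (subst integral_complex_of_real[symmetric]) (simp only: complex_norm_square mult.commute)

lemma nn_integral_cmod_square:
  assumes "f \<in> L2"
  shows "(\<integral>\<^sup>+x. ennreal ((cmod (f x))\<^sup>2) \<partial>lborel) = ennreal ((l2_norm f)\<^sup>2)"
  unfolding l2_norm_square by (rule nn_integral_eq_integral) (use assms in \<open>auto simp: L2_integrable_square\<close>)

lemma l2_norm_square_projection:
  assumes e: "\<And>m. e m \<in> L2" and on: "\<And>m n. l2_inner (e m) (e n) = (if m = n then 1 else 0)"
    and h: "h \<in> L2" and A: "finite A"
  shows "(l2_norm (\<lambda>x. \<Sum>m\<in>A. l2_inner (e m) h * e m x))\<^sup>2 = (\<Sum>m\<in>A. (cmod (l2_inner (e m) h))\<^sup>2)"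
    and "(l2_norm (\<lambda>x. h x - (\<Sum>m\<in>A. l2_inner (e m) h * e m x)))\<^sup>2
           = (l2_norm h)\<^sup>2 - (\<Sum>m\<in>A. (cmod (l2_inner (e m) h))\<^sup>2)"
proof -
  define p where "p = (\<lambda>x. \<Sum>m\<in>A. l2_inner (e m) h * e m x)"
  have p: "p \<in> L2" unfolding p_def by (rule L2_sum_smult) (rule e)
  have ep: "l2_inner (e m) p = l2_inner (e m) h" if "m \<in> A" for m
    unfolding p_def using that A
    by (subst l2_inner_sum_right) (auto simp: e on sum.delta if_distrib cong: if_cong)
  have hp: "l2_inner g p = (\<Sum>m\<in>A. l2_inner (e m) h * l2_inner g (e m))" if "g \<in> L2" for g
    unfolding p_def by (rule l2_inner_sum_right) (use that e in auto)
  have s: "l2_inner h p = complex_of_real (\<Sum>m\<in>A. (cmod (l2_inner (e m) h))\<^sup>2)"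
    unfolding hp[OF h] of_real_sum
    by (intro sum.cong refl) (metis complex_norm_square l2_inner_cnj)
  have pp: "l2_inner p p = l2_inner h p"
    unfolding hp[OF p] hp[OF h]
    by (intro sum.cong refl arg_cong2[where f="(*)"]) (metis ep l2_inner_cnj)
  then show "(l2_norm (\<lambda>x. \<Sum>m\<in>A. l2_inner (e m) h * e m x))\<^sup>2 = (\<Sum>m\<in>A. (cmod (l2_inner (e m) h))\<^sup>2)"
    unfolding s l2_inner_self of_real_eq_iff by (simp add: p_def)
  have ph: "l2_inner p h = complex_of_real (\<Sum>m\<in>A. (cmod (l2_inner (e m) h))\<^sup>2)"
    by (subst l2_inner_cnj[symmetric]) (simp add: s)
  define r where "r = (\<lambda>x. h x - p x)"
  have r: "r \<in> L2" unfolding r_def by (intro L2_diff h p)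
  have ri: "l2_inner r g = l2_inner h g - l2_inner p g" if "g \<in> L2" for g
  proof -
    have "l2_inner r g = cnj (l2_inner g r)" by (rule l2_inner_cnj[symmetric])
    also have "\<dots> = cnj (l2_inner g h - l2_inner g p)"
      unfolding r_def by (subst l2_inner_diff_right) (use that h p in auto)
    finally show ?thesis by (simp add: l2_inner_cnj)
  qed
  have "l2_inner r r = l2_inner r h - l2_inner r p"
    by (subst (2) r_def, rule l2_inner_diff_right) (use r h p in auto)
  then have "l2_inner r r = l2_inner h h - l2_inner p h"
    by (simp add: ri h p pp)
  then have "complex_of_real ((l2_norm r)\<^sup>2)
     = complex_of_real ((l2_norm h)\<^sup>2 - (\<Sum>m\<in>A. (cmod (l2_inner (e m) h))\<^sup>2))"
    by (simp only: l2_inner_self ph of_real_diff)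
  then show "(l2_norm (\<lambda>x. h x - (\<Sum>m\<in>A. l2_inner (e m) h * e m x)))\<^sup>2
           = (l2_norm h)\<^sup>2 - (\<Sum>m\<in>A. (cmod (l2_inner (e m) h))\<^sup>2)"
    unfolding r_def p_def of_real_eq_iff .
qed

lemma Bessel_inequality:
  assumes "\<And>m. e m \<in> L2" "\<And>m n. l2_inner (e m) (e n) = (if m = n then 1 else 0)" "h \<in> L2" "finite A"
  shows "(\<Sum>m\<in>A. (cmod (l2_inner (e m) h))\<^sup>2) \<le> (l2_norm h)\<^sup>2"
  using l2_norm_square_projection(2)[OF assms] by (smt (verit) zero_le_power2)

text \<open>
  The weights \<open>2 ^ j\<close> make finiteness of the series force geometric decay of the increments, hence
  absolute summability.  Squares rather than absolute values are what an \<open>L2\<close> bound controls.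
\<close>

lemma convergent_if_fast_square_differences:
  fixes r :: "nat \<Rightarrow> complex"
  assumes "(\<Sum>j. ennreal (2 ^ j * (cmod (r (Suc j) - r j))\<^sup>2)) \<noteq> \<infinity>"
  shows "convergent r"
proof -
  have "summable (\<lambda>j. 2 ^ j * (cmod (r (Suc j) - r j))\<^sup>2)"
    using assms by (intro summable_suminf_not_top) auto
  then have "Bseq (\<lambda>j. 2 ^ j * (cmod (r (Suc j) - r j))\<^sup>2)"
    by (intro convergent_imp_Bseq) (auto dest: summable_LIMSEQ_zero simp: convergent_def)
  then obtain B where B: "0 < B" "\<And>j. 2 ^ j * (cmod (r (Suc j) - r j))\<^sup>2 \<le> B"
    by (auto simp: Bseq_def)
  have "cmod (r (Suc j) - r j) \<le> sqrt B * sqrt (1/2) ^ j" for j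
  proof -
    have "(cmod (r (Suc j) - r j))\<^sup>2 \<le> B * (1/2) ^ j"
      using B(2)[of j] by (simp add: field_simps power_one_over)
    then have "sqrt ((cmod (r (Suc j) - r j))\<^sup>2) \<le> sqrt (B * (1/2) ^ j)"
      by (rule real_sqrt_le_mono)
    then show ?thesis by (simp add: real_sqrt_mult real_sqrt_power)
  qed
  moreover have "summable (\<lambda>j. sqrt B * sqrt (1/2) ^ j)"
    by (intro summable_mult summable_geometric) (simp add: real_sqrt_lt_1_iff)
  ultimately have "summable (\<lambda>j. r (Suc j) - r j)"
    using summable_comparison_test'[of "\<lambda>j. sqrt B * sqrt (1/2) ^ j" 0 "\<lambda>j. r (Suc j) - r j"] by blast
  then obtain l where "(\<lambda>n. \<Sum>j<n. r (Suc j) - r j) \<longlonglongrightarrow> l"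
    by (auto simp: summable_def sums_def)
  then have "(\<lambda>n. r n - r 0) \<longlonglongrightarrow> l" by (simp add: sum_lessThan_telescope)
  then have "(\<lambda>n. (r n - r 0) + r 0) \<longlonglongrightarrow> l + r 0" by (intro tendsto_intros)
  then show ?thesis by (auto simp: convergent_def)
qed

text \<open>
  Completeness of \<open>L2\<close>, for sequences that are already rapidly Cauchy: almost every pointwise sequence
  of values converges by the preceding lemma, and Fatou's lemma bounds the distance to the limit.
\<close>

lemma Riesz_Fischer:
  assumes r: "\<And>j. r j \<in> L2"
    and fast: "\<And>i j. j \<le> i \<Longrightarrow> (l2_norm (\<lambda>x. r i x - r j x))\<^sup>2 \<le> (1/4) ^ j"
  obtains g where "g \<in> L2" "(\<lambda>j. (l2_norm (\<lambda>x. g x - r j x))\<^sup>2) \<longlonglongrightarrow> 0"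
proof -
  have [measurable]: "r j \<in> borel_measurable borel" for j
    using r by (auto dest: L2_measurable)
  define g where "g = (\<lambda>x. lim (\<lambda>j. r j x))"
  have g[measurable]: "g \<in> borel_measurable borel"
    unfolding g_def by measurable
  have "(\<integral>\<^sup>+x. (\<Sum>j. ennreal (2 ^ j * (cmod (r (Suc j) x - r j x))\<^sup>2)) \<partial>lborel)
      = (\<Sum>j. \<integral>\<^sup>+x. ennreal (2 ^ j * (cmod (r (Suc j) x - r j x))\<^sup>2) \<partial>lborel)"
    by (rule nn_integral_suminf) measurable
  also have "\<dots> = (\<Sum>j. ennreal (2 ^ j * (l2_norm (\<lambda>x. r (Suc j) x - r j x))\<^sup>2))"
    by (intro suminf_cong)
       (simp add: ennreal_mult nn_integral_cmult nn_integral_cmod_square[OF L2_diff] r)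
  also have "\<dots> \<le> (\<Sum>j. ennreal ((1/2) ^ j))"
  proof (intro suminf_le ennreal_leI)
    fix j
    have "2 ^ j * (l2_norm (\<lambda>x. r (Suc j) x - r j x))\<^sup>2 \<le> 2 ^ j * (1/4) ^ j"
      using fast[of j "Suc j"] by (intro mult_left_mono) auto
    also have "\<dots> = (1/2) ^ j" by (simp flip: power_mult_distrib)
    finally show "2 ^ j * (l2_norm (\<lambda>x. r (Suc j) x - r j x))\<^sup>2 \<le> (1/2) ^ j" .
  qed auto
  also have "\<dots> < \<infinity>"
    by (subst suminf_ennreal2) (auto intro!: summable_geometric)
  finally have "AE x in lborel. (\<Sum>j. ennreal (2 ^ j * (cmod (r (Suc j) x - r j x))\<^sup>2)) \<noteq> \<infinity>"
    by (intro nn_integral_PInf_AE) auto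
  then have lim: "AE x in lborel. (\<lambda>j. r j x) \<longlonglongrightarrow> g x"
  proof eventually_elim
    case (elim x)
    then show ?case
      using convergent_if_fast_square_differences[OF elim] by (simp add: g_def convergent_LIMSEQ_iff)
  qed
  \<comment> \<open>Fatou, applied to the distances from the later terms of the sequence\<close>
  have bound: "(\<integral>\<^sup>+x. ennreal ((cmod (g x - r j x))\<^sup>2) \<partial>lborel) \<le> ennreal ((1/4) ^ j)" for j
  proof -
    have "(\<integral>\<^sup>+x. ennreal ((cmod (g x - r j x))\<^sup>2) \<partial>lborel)
        = (\<integral>\<^sup>+x. liminf (\<lambda>i. ennreal ((cmod (r i x - r j x))\<^sup>2)) \<partial>lborel)"
      using lim
    proof (intro nn_integral_cong_AE, eventually_elim)
      case (elim x)
      then have "(\<lambda>i. ennreal ((cmod (r i x - r j x))\<^sup>2)) \<longlonglongrightarrow> ennreal ((cmod (g x - r j x))\<^sup>2)"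
        by (intro tendsto_intros tendsto_ennrealI)
      then show ?case by (intro lim_imp_Liminf[symmetric]) simp_all
    qed
    also have "\<dots> \<le> liminf (\<lambda>i. \<integral>\<^sup>+x. ennreal ((cmod (r i x - r j x))\<^sup>2) \<partial>lborel)"
      by (rule nn_integral_liminf) measurable
    also have "\<dots> \<le> limsup (\<lambda>i. \<integral>\<^sup>+x. ennreal ((cmod (r i x - r j x))\<^sup>2) \<partial>lborel)"
      by (rule Liminf_le_Limsup) simp
    also have "\<dots> \<le> ennreal ((1/4) ^ j)"
      by (intro Limsup_bounded eventually_sequentiallyI[of j])
         (simp add: nn_integral_cmod_square[OF L2_diff] r fast ennreal_leI)
    finally show ?thesis .
  qed
  have "(\<lambda>x. g x - r 0 x) \<in> L2"
    unfolding L2_iff_nn_integral using bound[of 0] by (auto simp: less_top[symmetric] top_unique)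
  then have "(\<lambda>x. 1 * (g x - r 0 x) + 1 * r 0 x) \<in> L2"
    by (intro L2_combine r)
  then have gL: "g \<in> L2" by simp
  moreover have "(\<lambda>j. (l2_norm (\<lambda>x. g x - r j x))\<^sup>2) \<longlonglongrightarrow> 0"
  proof (rule tendsto_sandwich[OF _ _ tendsto_const])
    show "\<forall>\<^sub>F j in sequentially. (l2_norm (\<lambda>x. g x - r j x))\<^sup>2 \<le> (1/4) ^ j"
      using bound by (simp add: nn_integral_cmod_square[OF L2_diff] gL r)
    show "(\<lambda>j. (1/4) ^ j :: real) \<longlonglongrightarrow> 0" by (rule LIMSEQ_power_zero) simp
  qed auto
  ultimately show thesis by (rule that)
qed

text \<open>
  The remainders of the expansion of \<open>h\<close> converge in \<open>L2\<close>, after thinning, to some \<open>g\<close> that is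
  orthogonal to every basis vector.  Completeness of the basis gives \<open>g = 0\<close> almost everywhere, so the
  norms of the remainders tend to 0.
\<close>

theorem Parseval:
  assumes "orthonormal_basis e" and h: "h \<in> L2"
  shows "(\<lambda>m. (cmod (l2_inner (e m) h))\<^sup>2) sums (l2_norm h)\<^sup>2"
proof -
  have e: "\<And>m. e m \<in> L2" and on: "\<And>m n. l2_inner (e m) (e n) = (if m = n then 1 else 0)"
    and complete: "\<And>f. f \<in> L2 \<Longrightarrow> (\<And>m. l2_inner (e m) f = 0) \<Longrightarrow> AE x in lborel. f x = 0"
    using assms(1) by (auto simp: orthonormal_basis_def)
  define c where "c m = (cmod (l2_inner (e m) h))\<^sup>2" for m
  have summ: "summable c"
    unfolding c_def using Bessel_inequality[OF e on h] by (intro summableI_nonneg_bounded) auto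
  define tail where "tail n = (\<Sum>m. c (m + n))" for n
  have "tail \<longlonglongrightarrow> 0"
    unfolding tail_def using suminf_exist_split2[OF summ] by simp
  then have ex: "\<exists>n. tail n \<le> (1/4) ^ j" for j
    using order_tendstoD(2)[of tail 0 sequentially "(1/4) ^ j"] eventually_happens' sequentially_bot
    by (metis less_imp_le zero_less_divide_1_iff zero_less_numeral zero_less_power)
  have block: "sum c {a..<b} \<le> tail a" for a b
  proof -
    have "sum c {a..<b} = (\<Sum>m<b - a. c (m + a))"
    proof (cases "a \<le> b")
      case True
      then show ?thesis
        using sum.shift_bounds_nat_ivl[of c 0 a "b - a"] by (simp add: atLeast0LessThan)
    qed auto
    also have "\<dots> \<le> tail a"
      unfolding tail_def using summable_ignore_initial_segment[OF summ, of a] by (intro sum_le_suminf) (auto simp: c_def)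
    finally show ?thesis .
  qed
  \<comment> \<open>The summand \<open>j\<close> guarantees that \<open>\<phi>\<close> is unbounded even if the tail vanishes early.\<close>
  define \<phi> where "\<phi> j = j + (LEAST n. tail n \<le> (1/4) ^ j)" for j
  have tail_antimono: "tail b \<le> tail a" if "a \<le> b" for a b
  proof -
    have "tail n = (\<Sum>m. c m) - sum c {..<n}" for n
      unfolding tail_def using suminf_split_initial_segment[OF summ, of n] by simp
    moreover have "sum c {..<a} \<le> sum c {..<b}"
      using that by (intro sum_mono2) (auto simp: c_def)
    ultimately show ?thesis by simp
  qed
  have tail_\<phi>: "tail (\<phi> j) \<le> (1/4) ^ j" for j
  proof -
    have "tail (LEAST n. tail n \<le> (1/4) ^ j) \<le> (1/4) ^ j"
      using ex by (rule LeastI_ex)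
    then show ?thesis
      using tail_antimono[of "LEAST n. tail n \<le> (1/4) ^ j" "\<phi> j"] by (simp add: \<phi>_def)
  qed
  have mono: "\<phi> j \<le> \<phi> i" if "j \<le> i" for i j
  proof -
    have "tail (LEAST n. tail n \<le> (1/4) ^ i) \<le> (1/4) ^ i"
      using ex by (rule LeastI_ex)
    also have "(1/4) ^ i \<le> ((1/4) ^ j :: real)"
      using that by (intro power_decreasing) auto
    finally show ?thesis using that by (auto simp: \<phi>_def intro!: add_mono Least_le)
  qed
  define r where "r j = (\<lambda>x. h x - (\<Sum>m<\<phi> j. l2_inner (e m) h * e m x))" for j
  have r: "r j \<in> L2" for j
    unfolding r_def by (intro L2_diff h L2_sum_smult e)
  have fast: "(l2_norm (\<lambda>x. r i x - r j x))\<^sup>2 \<le> (1/4) ^ j" if "j \<le> i" for i j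
  proof -
    have "r i x - r j x = - (\<Sum>m\<in>{\<phi> j..<\<phi> i}. l2_inner (e m) h * e m x)" for x
    proof -
      have "{..<\<phi> i} = {..<\<phi> j} \<union> {\<phi> j..<\<phi> i}" using mono[OF that] by auto
      moreover have "(\<Sum>m\<in>{..<\<phi> j} \<union> {\<phi> j..<\<phi> i}. l2_inner (e m) h * e m x)
          = (\<Sum>m\<in>{..<\<phi> j}. l2_inner (e m) h * e m x) + (\<Sum>m\<in>{\<phi> j..<\<phi> i}. l2_inner (e m) h * e m x)"
        by (rule sum.union_disjoint) auto
      ultimately show ?thesis by (simp add: r_def)
    qed
    then have "(l2_norm (\<lambda>x. r i x - r j x))\<^sup>2 = sum c {\<phi> j..<\<phi> i}"
      using l2_norm_square_projection(1)[OF e on h, of "{\<phi> j..<\<phi> i}"]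
      by (simp add: l2_norm_def c_def sum_nonneg)
    also have "\<dots> \<le> (1/4) ^ j" using block tail_\<phi> order_trans by blast
    finally show ?thesis .
  qed
  obtain g where g: "g \<in> L2" and lim: "(\<lambda>j. (l2_norm (\<lambda>x. g x - r j x))\<^sup>2) \<longlonglongrightarrow> 0"
    by (rule Riesz_Fischer[OF r fast])
  have "l2_inner (e m) g = 0" for m
  proof -
    have "(cmod (l2_inner (e m) g))\<^sup>2 \<le> (l2_norm (\<lambda>x. g x - r j x))\<^sup>2" if "m < j" for j
    proof -
      have "l2_inner (e m) (r j) = 0"
      proof -
        have "m \<in> {..<\<phi> j}" using that by (simp add: \<phi>_def)
        have "l2_inner (e m) (r j) = l2_inner (e m) h - (\<Sum>i<\<phi> j. l2_inner (e i) h * l2_inner (e m) (e i))"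
          unfolding r_def by (simp only: l2_inner_diff_right[OF e h L2_sum_smult[OF e]] l2_inner_sum_right[OF e e])
        also have "(\<Sum>i<\<phi> j. l2_inner (e i) h * l2_inner (e m) (e i)) = (\<Sum>i<\<phi> j. if m = i then l2_inner (e i) h else 0)"
          by (intro sum.cong refl) (simp add: on)
        also have "\<dots> = l2_inner (e m) h" using \<open>m \<in> {..<\<phi> j}\<close> by (subst sum.delta') auto
        finally show ?thesis by simp
      qed
      then have "l2_inner (e m) g = l2_inner (e m) (\<lambda>x. g x - r j x)"
        by (simp add: l2_inner_diff_right e g r)
      then show ?thesis
        using Bessel_inequality[OF e on L2_diff[OF g r], of "{m}"] by simp
    qed
    then have "(cmod (l2_inner (e m) g))\<^sup>2 \<le> 0"
      by (intro tendsto_lowerbound[OF lim] eventually_sequentiallyI[of "Suc m"]) auto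
    then show ?thesis by simp
  qed
  then have "AE x in lborel. g x = 0" by (intro complete g)
  moreover have [measurable]: "g \<in> borel_measurable borel" "r j \<in> borel_measurable borel" for j
    using g r by (auto dest: L2_measurable)
  ultimately have "l2_norm (\<lambda>x. g x - r j x) = l2_norm (r j)" for j
    unfolding l2_norm_def
    by (intro arg_cong[where f = sqrt] integral_cong_AE) (auto elim!: eventually_mono)
  with lim have "(\<lambda>j. (l2_norm (r j))\<^sup>2) \<longlonglongrightarrow> 0" by simp
  then have "(\<lambda>j. (l2_norm h)\<^sup>2 - sum c {..<\<phi> j}) \<longlonglongrightarrow> 0"
    unfolding r_def by (simp add: l2_norm_square_projection(2)[OF e on h] c_def)
  then have "(\<lambda>j. (l2_norm h)\<^sup>2 - ((l2_norm h)\<^sup>2 - sum c {..<\<phi> j})) \<longlonglongrightarrow> (l2_norm h)\<^sup>2 - 0"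
    by (intro tendsto_intros)
  then have "(\<lambda>j. sum c {..<\<phi> j}) \<longlonglongrightarrow> (l2_norm h)\<^sup>2" by simp
  moreover have "filterlim \<phi> at_top sequentially"
    by (rule filterlim_at_top_mono[OF filterlim_ident]) (simp add: \<phi>_def)
  then have "(\<lambda>j. sum c {..<\<phi> j}) \<longlonglongrightarrow> suminf c"
    using summable_LIMSEQ[OF summ] by (rule filterlim_compose[rotated])
  ultimately have "suminf c = (l2_norm h)\<^sup>2" by (rule LIMSEQ_unique[rotated])
  with summ show ?thesis unfolding c_def by (metis summable_sums)
qed

section \<open>The trace of a compressed projection\<close>

lemma l2_inner_cong_AE:
  assumes "f \<in> L2" "g \<in> L2" "h \<in> L2" "AE x in lborel. g x = h x"
  shows "l2_inner f g = l2_inner f h"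
proof -
  have "(\<lambda>x. cnj (f x) * g x) \<in> borel_measurable lborel" "(\<lambda>x. cnj (f x) * h x) \<in> borel_measurable lborel"
    using L2_integrable_product assms by (auto dest!: borel_measurable_integrable)
  then show ?thesis
    unfolding l2_inner_def using assms(4) by (intro integral_cong_AE) (auto elim!: eventually_mono)
qed

text \<open>
  On functions supported in the positive half-line the quadratic form of \<open>K\<close> is that of the projection
  \<open>T = K_hat K\<close>, and a projection satisfies \<open>\<langle>g, T g\<rangle> = \<parallel>T g\<parallel>\<^sup>2\<close>.  On the negative half-line the
  same argument applies to the complementary projection, since there \<open>T g - g\<close> is \<open>sgn \<cdot> K g\<close>.  In
  both cases multiplication by \<open>sgn\<close> does not change the norm.
\<close>

lemma projection_quadratic_form:
  assumes K: "bounded_kernel K" and proj: "orthogonal_projection (K_hat K)"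
    and g: "g \<in> L2" and D: "D \<subseteq> {0<..} \<or> D \<subseteq> {..<0}" "\<And>x. x \<notin> D \<Longrightarrow> g x = 0"
  shows "l2_inner g (integral_op K g) = complex_of_real ((l2_norm (integral_op K g))\<^sup>2)"
proof -
  define u where "u = integral_op K g"
  define T where "T = K_hat K g"
  have u: "u \<in> L2" using K g by (simp add: u_def bounded_kernel_def bounded_op_def)
  have T: "T \<in> L2" using proj g by (simp add: T_def orthogonal_projection_def bounded_op_def)
  have TT: "K_hat K T \<in> L2" using proj T by (simp add: orthogonal_projection_def bounded_op_def)
  have "l2_inner T T = l2_inner g (K_hat K T)"
    using proj g T by (simp add: T_def orthogonal_projection_def)
  also have "\<dots> = l2_inner g T"
    using proj by (intro l2_inner_cong_AE g T TT) (use g in \<open>auto simp: T_def orthogonal_projection_def\<close>)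
  finally have TgT: "l2_inner T T = l2_inner g T" .
  have gT: "l2_inner g T = l2_inner T g"
    using proj g by (simp add: T_def orthogonal_projection_def)
  have norm_sgn: "l2_inner v v = l2_inner u u" if "\<And>x. v x = of_real (sgn x) * u x" for v
  proof -
    have "AE x in lborel. x \<noteq> (0 :: real)" by (rule AE_lborel_singleton)
    then have "AE x in lborel. (cmod (v x))\<^sup>2 = (cmod (u x))\<^sup>2"
      by eventually_elim (simp add: that norm_mult)
    moreover have [measurable]: "u \<in> borel_measurable borel" using u by (rule L2_measurable)
    have [measurable]: "v \<in> borel_measurable borel" unfolding that[abs_def] by measurable
    ultimately have "l2_norm v = l2_norm u"
      unfolding l2_norm_def by (intro arg_cong[where f = sqrt] integral_cong_AE) auto
    then show ?thesis by (simp add: l2_inner_self)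
  qed
  have Tx: "T x = of_real (sgn x) * u x + indicator {..<0} x * g x" for x
    by (simp add: T_def K_hat_def mult_op_def chi_def u_def)
  show ?thesis
    unfolding u_def[symmetric]
  proof (cases "D \<subseteq> {0<..}")
    case True
    have pos: "0 < x" if "g x \<noteq> 0" for x using that D(2) True by auto
    have "T x = of_real (sgn x) * u x" for x
      using pos[of x] by (cases "g x = 0") (auto simp: Tx indicator_def)
    then have "l2_inner T T = l2_inner u u" by (rule norm_sgn)
    moreover have "cnj (g x) * T x = cnj (g x) * u x" for x
      using pos[of x] by (cases "g x = 0") (auto simp: Tx indicator_def)
    then have "l2_inner g T = l2_inner g u" by (simp only: l2_inner_def)
    ultimately show "l2_inner g u = complex_of_real ((l2_norm u)\<^sup>2)"
      using TgT by (simp add: l2_inner_self)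
  next
    case False
    then have neg: "x < 0" if "g x \<noteq> 0" for x using that D by auto
    define v where "v = (\<lambda>x. T x - g x)"
    have v: "v \<in> L2" unfolding v_def by (intro L2_diff T g)
    have vx: "v x = of_real (sgn x) * u x" for x
      using neg[of x] by (auto simp: v_def Tx indicator_def)
    have vv: "l2_inner v v = l2_inner u u" using vx by (rule norm_sgn)
    have "l2_inner T v = 0"
      unfolding v_def using T g TgT gT by (simp add: l2_inner_diff_right)
    then have "l2_inner v T = 0" by (metis l2_inner_cnj complex_cnj_zero)
    moreover have "l2_inner v v = l2_inner v T - l2_inner v g"
      by (subst (2) v_def, rule l2_inner_diff_right) (use v T g in auto)
    moreover have "l2_inner v g = - l2_inner u g"
    proof -
      have "cnj (v x) * g x = - (cnj (u x) * g x)" for x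
        using neg[of x] by (cases "g x = 0") (auto simp: vx)
      then show ?thesis by (simp add: l2_inner_def)
    qed
    ultimately have "l2_inner u u = l2_inner u g" using vv by simp
    then show "l2_inner g u = complex_of_real ((l2_norm u)\<^sup>2)"
      by (metis l2_inner_self l2_inner_cnj complex_cnj_complex_of_real)
  qed
qed

text \<open>
  For a projection, the trace of its compression to \<open>D\<close> is the sum of \<open>\<parallel>K \<chi>\<^sub>D e\<^sub>m\<parallel>\<^sup>2\<close> over a basis.
  Exchanging this sum with the integral over \<open>x\<close> leaves the squared Fourier coefficients of the row
  \<open>K(x, \<cdot>)\<close> restricted to \<open>D\<close>, which Parseval adds up.  The hypothesis on the rows is
  genuine: boundedness of the operator alone does not put them in \<open>L2\<close>.
\<close>

lemma trace_eq_Hilbert_Schmidt_norm: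
  assumes K: "lytvynov_condition K" and diag: "diagonal_gives_traces K"
    and D: "D \<in> sets borel" "bounded D" "D \<subseteq> {0<..} \<or> D \<subseteq> {..<0}"
    and rows: "AE x in lborel. (\<lambda>y. indicator D y * cnj (K x y)) \<in> L2"
  shows "(\<integral>\<^sup>+x. (\<integral>\<^sup>+y. ennreal ((cmod (K x y))\<^sup>2) * indicator D y \<partial>lborel) \<partial>lborel)
    = ennreal (LINT x:D|lborel. Re (K x x))"
proof -
  have bk: "bounded_kernel K" and proj: "orthogonal_projection (K_hat K)"
    using K by (auto simp: lytvynov_condition_def)
  define S where "S = chi D \<circ> integral_op K \<circ> chi D"
  have int: "set_integrable lborel D (\<lambda>x. K x x)" and tr: "has_trace S (LINT x:D|lborel. K x x)"
    using diag D by (auto simp: diagonal_gives_traces_def S_def)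
  obtain e where e: "orthonormal_basis e"
    using tr by (auto simp: has_trace_def trace_class_def)
  have eL: "e m \<in> L2" for m using e by (simp add: orthonormal_basis_def)
  define g where "g m = chi D (e m)" for m
  have gx: "g m x = indicator D x * e m x" for m x by (simp add: g_def chi_def mult_op_def)
  have gL: "g m \<in> L2" for m
  proof -
    have [measurable]: "e m \<in> borel_measurable borel" using eL by (rule L2_measurable)
    have "(\<integral>\<^sup>+x. ennreal ((cmod (g m x))\<^sup>2) \<partial>lborel) \<le> (\<integral>\<^sup>+x. ennreal ((cmod (e m x))\<^sup>2) \<partial>lborel)"
      by (intro nn_integral_mono ennreal_leI) (auto simp: gx indicator_def)
    also have "\<dots> < \<infinity>" using eL[of m] by (simp add: L2_iff_nn_integral)
    finally show ?thesis unfolding L2_iff_nn_integral gx[abs_def] using D(1) by simp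
  qed
  define u where "u m = integral_op K (g m)" for m
  have uL: "u m \<in> L2" for m using bk gL by (simp add: u_def bounded_kernel_def bounded_op_def)
  have "l2_inner (e m) (S (e m)) = complex_of_real ((l2_norm (u m))\<^sup>2)" for m
  proof -
    have "cnj (e m x) * S (e m) x = cnj (g m x) * u m x" for x
      by (auto simp: S_def u_def g_def chi_def mult_op_def indicator_def)
    then have "l2_inner (e m) (S (e m)) = l2_inner (g m) (u m)"
      by (simp add: l2_inner_def)
    also have "\<dots> = complex_of_real ((l2_norm (u m))\<^sup>2)"
      unfolding u_def by (rule projection_quadratic_form[OF bk proj gL D(3)]) (simp add: gx)
    finally show ?thesis .
  qed
  moreover have "(\<lambda>m. l2_inner (e m) (S (e m))) sums (LINT x:D|lborel. K x x)"
    using tr e by (simp add: has_trace_def)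
  ultimately have "(\<lambda>m. complex_of_real ((l2_norm (u m))\<^sup>2)) sums (LINT x:D|lborel. K x x)"
    by (simp only:)
  then have "(\<lambda>m. (l2_norm (u m))\<^sup>2) sums Re (LINT x:D|lborel. K x x)"
    using sums_Re by fastforce
  also have "Re (LINT x:D|lborel. K x x) = (LINT x:D|lborel. Re (K x x))"
    using int by (simp add: set_lebesgue_integral_def set_integrable_def flip: integral_Re)
  finally have sums: "(\<lambda>m. (l2_norm (u m))\<^sup>2) sums (LINT x:D|lborel. Re (K x x))" .
  have [measurable]: "u m \<in> borel_measurable borel" for m using uL by (rule L2_measurable)
  have "(\<integral>\<^sup>+x. (\<integral>\<^sup>+y. ennreal ((cmod (K x y))\<^sup>2) * indicator D y \<partial>lborel) \<partial>lborel)
      = (\<integral>\<^sup>+x. (\<Sum>m. ennreal ((cmod (u m x))\<^sup>2)) \<partial>lborel)"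
    using rows
  proof (intro nn_integral_cong_AE, eventually_elim)
    case elim: (elim x)
    define h where "h = (\<lambda>y. indicator D y * cnj (K x y))"
    have "(\<lambda>m. (cmod (l2_inner (e m) h))\<^sup>2) sums (l2_norm h)\<^sup>2"
      using e elim(2) unfolding h_def by (rule Parseval)
    moreover have "cmod (l2_inner (e m) h) = cmod (u m x)" for m
    proof -
      have "cnj (h y) * e m y = K x y * g m y" for y
        by (simp add: h_def gx indicator_def)
      then have "l2_inner h (e m) = u m x" by (simp add: l2_inner_def u_def integral_op_def)
      then show ?thesis by (metis l2_inner_cnj complex_mod_cnj)
    qed
    ultimately have "(\<Sum>m. ennreal ((cmod (u m x))\<^sup>2)) = ennreal ((l2_norm h)\<^sup>2)"
      by (intro suminf_ennreal_eq) auto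
    also have "\<dots> = (\<integral>\<^sup>+y. ennreal ((cmod (h y))\<^sup>2) \<partial>lborel)"
      by (rule nn_integral_cmod_square[symmetric]) (use elim in \<open>simp add: h_def\<close>)
    also have "\<dots> = (\<integral>\<^sup>+y. ennreal ((cmod (K x y))\<^sup>2) * indicator D y \<partial>lborel)"
      by (intro nn_integral_cong) (auto simp: h_def indicator_def)
    finally show ?case by simp
  qed
  also have "\<dots> = (\<Sum>m. \<integral>\<^sup>+x. ennreal ((cmod (u m x))\<^sup>2) \<partial>lborel)"
    by (rule nn_integral_suminf) measurable
  also have "\<dots> = (\<Sum>m. ennreal ((l2_norm (u m))\<^sup>2))"
    by (simp add: nn_integral_cmod_square uL)
  also have "\<dots> = ennreal (LINT x:D|lborel. Re (K x x))"
    using sums by (intro suminf_ennreal_eq) auto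
  finally show ?thesis .
qed

section \<open>Dirichlet forms on the integers\<close>

definition window :: "nat \<Rightarrow> int set" where
  "window L = {- int L..int L}"

lemma finite_window [simp]: "finite (window L)"
  by (simp add: window_def)

lemma window_mono: "L \<le> L' \<Longrightarrow> window L \<subseteq> window L'"
  by (auto simp: window_def)

lemma finite_subset_window:
  assumes "finite A"
  obtains L where "A \<subseteq> window L"
proof
  show "A \<subseteq> window (nat (\<Sum>i\<in>A. \<bar>i\<bar>))"
  proof
    fix i assume "i \<in> A"
    then have "\<bar>i\<bar> \<le> (\<Sum>i\<in>A. \<bar>i\<bar>)" using assms by (intro member_le_sum) auto
    then show "i \<in> window (nat (\<Sum>i\<in>A. \<bar>i\<bar>))" by (auto simp: window_def)
  qed
qed

text \<open>
  Linear interpolation of a cutoff at scale \<open>R\<close>.  Its slope \<open>1/R\<close> on a set of size \<open>2R\<close> is what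
  keeps the Dirichlet form bounded when the tails of the weights decay like \<open>1/R\<close>; for weights of
  exact order \<open>1/(i - j)\<^sup>2\<close> the indicator of an interval has a logarithmically growing form.
\<close>

definition tent :: "nat \<Rightarrow> int \<Rightarrow> real" where
  "tent R i = max 0 (1 - \<bar>i\<bar> / R)"

lemma tent_nonneg: "0 \<le> tent R i" and tent_le_1: "tent R i \<le> 1"
  by (auto simp: tent_def)

lemma tent_eq_0: "0 < R \<Longrightarrow> i \<notin> window R \<Longrightarrow> tent R i = 0"
  by (auto simp: tent_def window_def field_simps abs_if split: if_splits)

lemma supp_tent: "0 < R \<Longrightarrow> {i. tent R i \<noteq> 0} \<subseteq> window R"
  using tent_eq_0 by blast

lemma tent_lower:
  fixes J R :: nat
  assumes "0 < J" "J \<le> R"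
  shows "1 - \<bar>i\<bar> / J \<le> tent R i"
proof -
  have "real_of_int \<bar>i\<bar> / R \<le> real_of_int \<bar>i\<bar> / J"
    using assms by (intro divide_left_mono) auto
  then show ?thesis unfolding tent_def by linarith
qed

lemma tendsto_tent: "(\<lambda>R. tent R i) \<longlonglongrightarrow> 1"
proof -
  have "(\<lambda>R. max 0 (1 - real_of_int \<bar>i\<bar> / real R)) \<longlonglongrightarrow> max 0 (1 - 0)"
    by (intro tendsto_intros lim_const_over_n)
  then show ?thesis by (simp add: tent_def[abs_def])
qed

lemma tent_diff_square_le:
  assumes "0 < R"
  shows "(tent R i - tent R j)\<^sup>2 \<le> (min 1 (\<bar>i - j\<bar> / R))\<^sup>2"
proof -
  have "\<bar>tent R i - tent R j\<bar> \<le> \<bar>\<bar>i\<bar> / R - \<bar>j\<bar> / R\<bar>"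
    unfolding tent_def of_int_abs by (simp add: max_def abs_if)
  also have "\<dots> = \<bar>real_of_int (\<bar>i\<bar> - \<bar>j\<bar>)\<bar> / R"
    by (simp flip: diff_divide_distrib)
  also have "\<dots> \<le> \<bar>i - j\<bar> / R"
    by (intro divide_right_mono) auto
  finally have "\<bar>tent R i - tent R j\<bar> \<le> \<bar>i - j\<bar> / R" .
  moreover have "\<bar>tent R i - tent R j\<bar> \<le> 1"
    using tent_nonneg[of R i] tent_nonneg[of R j] tent_le_1[of R i] tent_le_1[of R j] by linarith
  ultimately have "\<bar>tent R i - tent R j\<bar> \<le> min 1 (\<bar>i - j\<bar> / R)" by simp
  then have "\<bar>tent R i - tent R j\<bar>\<^sup>2 \<le> (min 1 (\<bar>i - j\<bar> / R))\<^sup>2"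
    by (intro power_mono) auto
  then show ?thesis by simp
qed

abbreviation supp :: "(int \<Rightarrow> real) \<Rightarrow> int set" where
  "supp f \<equiv> {i. f i \<noteq> 0}"

text \<open>
  Symmetric non-negative weights on pairs of integers with row sums \<open>\<kappa>\<close>.  The row sums are taken along
  symmetric windows; for non-negative terms this is the unconditional sum.
\<close>

locale coupling =
  fixes k :: "int \<Rightarrow> int \<Rightarrow> real" and \<kappa> :: "int \<Rightarrow> real"
  assumes nonneg: "0 \<le> k i j"
    and sym: "k i j = k j i"
    and row: "(\<lambda>L. \<Sum>j\<in>window L. k i j) \<longlonglongrightarrow> \<kappa> i"
begin

text \<open>
  The bilinear form that polarizes the Dirichlet form
  \<open>1/2 \<Sum>\<^sub>i \<Sum>\<^sub>j k i j * (f i - f j)\<^sup>2\<close>, expanded with the help of the row sums so that only finite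
  sums occur.
\<close>

definition form :: "(int \<Rightarrow> real) \<Rightarrow> (int \<Rightarrow> real) \<Rightarrow> real" where
  "form f g = (\<Sum>i\<in>supp f. f i * (\<kappa> i * g i - (\<Sum>j\<in>supp g. k i j * g j)))"

lemma form_superset:
  assumes "finite A" "finite B" "supp f \<subseteq> A" "supp g \<subseteq> B"
  shows "form f g = (\<Sum>i\<in>A. f i * (\<kappa> i * g i - (\<Sum>j\<in>B. k i j * g j)))"
proof -
  have "(\<Sum>j\<in>supp g. k i j * g j) = (\<Sum>j\<in>B. k i j * g j)" for i
    using assms by (intro sum.mono_neutral_left) auto
  moreover have "(\<Sum>i\<in>supp f. f i * (\<kappa> i * g i - (\<Sum>j\<in>B. k i j * g j)))
      = (\<Sum>i\<in>A. f i * (\<kappa> i * g i - (\<Sum>j\<in>B. k i j * g j)))"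
    using assms by (intro sum.mono_neutral_left) auto
  ultimately show ?thesis by (simp add: form_def)
qed

lemma form_square_superset:
  assumes "finite A" "supp f \<subseteq> A"
  shows "form f f = (\<Sum>i\<in>A. (f i)\<^sup>2 * \<kappa> i) - (\<Sum>i\<in>A. \<Sum>j\<in>A. f i * f j * k i j)"
  unfolding form_superset[OF assms(1,1,2,2)]
  by (simp add: right_diff_distrib sum_subtractf sum_distrib_left power2_eq_square mult_ac)

lemma form_add_square:
  assumes "finite (supp f)" "finite (supp g)"
  shows "form (\<lambda>i. f i + g i) (\<lambda>i. f i + g i) = form f f + form g g + 2 * form f g"
proof -
  define A where "A = supp f \<union> supp g"
  have A: "finite A" "supp f \<subseteq> A" "supp g \<subseteq> A" "supp (\<lambda>i. f i + g i) \<subseteq> A"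
    using assms by (auto simp: A_def)
  have swap: "(\<Sum>i\<in>A. \<Sum>j\<in>A. g i * f j * k i j) = (\<Sum>i\<in>A. \<Sum>j\<in>A. f i * g j * k i j)"
    by (subst sum.swap) (simp add: sym[of _ _] mult_ac)
  have fg: "form f g = (\<Sum>i\<in>A. f i * g i * \<kappa> i) - (\<Sum>i\<in>A. \<Sum>j\<in>A. f i * g j * k i j)"
    unfolding form_superset[OF A(1,1,2,3)]
    by (simp add: right_diff_distrib sum_subtractf sum_distrib_left mult_ac)
  have "(\<Sum>i\<in>A. \<Sum>j\<in>A. (f i + g i) * (f j + g j) * k i j)
     = (\<Sum>i\<in>A. \<Sum>j\<in>A. f i * f j * k i j) + (\<Sum>i\<in>A. \<Sum>j\<in>A. g i * g j * k i j)
       + ((\<Sum>i\<in>A. \<Sum>j\<in>A. f i * g j * k i j) + (\<Sum>i\<in>A. \<Sum>j\<in>A. g i * f j * k i j))"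
    by (simp add: algebra_simps sum.distrib)
  moreover have "(\<Sum>i\<in>A. (f i + g i)\<^sup>2 * \<kappa> i)
     = (\<Sum>i\<in>A. (f i)\<^sup>2 * \<kappa> i) + (\<Sum>i\<in>A. (g i)\<^sup>2 * \<kappa> i) + 2 * (\<Sum>i\<in>A. f i * g i * \<kappa> i)"
    by (simp add: power2_sum algebra_simps sum.distrib sum_distrib_left)
  ultimately show ?thesis
    unfolding form_square_superset[OF A(1,4)] form_square_superset[OF A(1,2)]
      form_square_superset[OF A(1,3)] fg swap by simp
qed

lemma form_scale:
  "form (\<lambda>i. c * f i) (\<lambda>i. c * f i) = c\<^sup>2 * form f f"
proof (cases "c = 0")
  case False
  then have "supp (\<lambda>i. c * f i) = supp f" by auto
  then show ?thesis
    unfolding form_def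
    by (simp add: sum_distrib_left right_diff_distrib power2_eq_square mult_ac)
qed (simp add: form_def)

lemma row_sum_le: "finite J \<Longrightarrow> (\<Sum>j\<in>J. k i j) \<le> \<kappa> i"
proof -
  assume "finite J"
  then obtain L where L: "J \<subseteq> window L" by (rule finite_subset_window)
  show ?thesis
  proof (rule tendsto_lowerbound[OF row[of i]], rule eventually_sequentiallyI[of L])
    fix L' assume "L \<le> L'"
    then show "(\<Sum>j\<in>J. k i j) \<le> (\<Sum>j\<in>window L'. k i j)"
      using L window_mono by (intro sum_mono2) (auto simp: nonneg)
  qed simp
qed

lemma row_nonneg: "0 \<le> \<kappa> i"
  using row_sum_le[of "{}" i] by simp

text \<open>
  For fixed \<open>i\<close> the bracket in the definition of the form tends to \<open>\<kappa> i - (\<Sum>\<^sub>j k i j) = 0\<close>, by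
  monotone convergence of the row sums.  Hence constants lie in the kernel of the form, and wide tents
  are asymptotically orthogonal to everything with finite support.
\<close>

lemma tendsto_form_tent:
  assumes "finite (supp g)"
  shows "(\<lambda>R. form g (tent R)) \<longlonglongrightarrow> 0"
proof -
  have lim: "(\<lambda>R. \<Sum>j\<in>window R. k i j * tent R j) \<longlonglongrightarrow> \<kappa> i" for i
  proof (rule order_tendstoI)
    \<comment> \<open>Finitely many terms already exceed \<open>a\<close>, and on them the tent tends to 1.\<close>
    fix a assume "a < \<kappa> i"
    then obtain L where L: "a < (\<Sum>j\<in>window L. k i j)"
      using order_tendstoD(1)[OF row] eventually_happens' sequentially_bot by blast
    have "(\<lambda>R. \<Sum>j\<in>window L. k i j * tent R j) \<longlonglongrightarrow> (\<Sum>j\<in>window L. k i j * 1)"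
      by (intro tendsto_intros tendsto_tent)
    then have "\<forall>\<^sub>F R in sequentially. a < (\<Sum>j\<in>window L. k i j * tent R j)"
      using L by (intro order_tendstoD(1)[of _ "\<Sum>j\<in>window L. k i j * 1"]) auto
    moreover have "\<forall>\<^sub>F R in sequentially. (\<Sum>j\<in>window L. k i j * tent R j) \<le> (\<Sum>j\<in>window R. k i j * tent R j)"
      by (rule eventually_sequentiallyI[of L])
         (intro sum_mono2, auto simp: nonneg tent_nonneg dest: window_mono)
    ultimately show "\<forall>\<^sub>F R in sequentially. a < (\<Sum>j\<in>window R. k i j * tent R j)"
      by eventually_elim simp
  next
    fix a assume a: "\<kappa> i < a"
    have "(\<Sum>j\<in>window R. k i j * tent R j) \<le> \<kappa> i" for R
    proof -
      have "(\<Sum>j\<in>window R. k i j * tent R j) \<le> (\<Sum>j\<in>window R. k i j)"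
        by (intro sum_mono) (simp add: nonneg tent_le_1 mult_left_le)
      also have "\<dots> \<le> \<kappa> i" by (rule row_sum_le) simp
      finally show ?thesis .
    qed
    then show "\<forall>\<^sub>F R in sequentially. (\<Sum>j\<in>window R. k i j * tent R j) < a"
      using a le_less_trans by (intro always_eventually allI) blast
  qed
  have "(\<lambda>R. \<Sum>i\<in>supp g. g i * (\<kappa> i * tent R i - (\<Sum>j\<in>window R. k i j * tent R j)))
      \<longlonglongrightarrow> (\<Sum>i\<in>supp g. g i * (\<kappa> i * 1 - \<kappa> i))"
    by (intro tendsto_intros tendsto_tent lim)
  then have "(\<lambda>R. \<Sum>i\<in>supp g. g i * (\<kappa> i * tent R i - (\<Sum>j\<in>window R. k i j * tent R j))) \<longlonglongrightarrow> 0"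
    by simp
  moreover have "\<forall>\<^sub>F R in sequentially. (\<Sum>i\<in>supp g. g i * (\<kappa> i * tent R i - (\<Sum>j\<in>window R. k i j * tent R j)))
      = form g (tent R)"
  proof (rule eventually_sequentiallyI[of 1])
    fix R :: nat assume "1 \<le> R"
    then have "supp (tent R) \<subseteq> window R" using tent_eq_0[of R] by auto
    then show "(\<Sum>i\<in>supp g. g i * (\<kappa> i * tent R i - (\<Sum>j\<in>window R. k i j * tent R j))) = form g (tent R)"
      by (intro form_superset[symmetric] assms) auto
  qed
  ultimately show ?thesis by (rule Lim_transform_eventually)
qed

end

text \<open>
  Among indices of modulus at least \<open>M\<close> the weights decay off the diagonal so fast that the truncated
  second moments of each row are at most \<open>C R\<close>, here divided by \<open>R\<^sup>2\<close>.
\<close>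

locale decaying_coupling = coupling +
  fixes M :: int and C :: real
  assumes decay: "\<And>(R::nat) (i::int) (J::int set). 1 \<le> R \<Longrightarrow> M \<le> \<bar>i\<bar> \<Longrightarrow> finite J \<Longrightarrow> (\<And>j. j \<in> J \<Longrightarrow> M \<le> \<bar>j\<bar>) \<Longrightarrow>
    (\<Sum>j\<in>J. (min 1 (real_of_int \<bar>i - j\<bar> / real R))\<^sup>2 * k i j) \<le> C / real R"
begin

definition bound :: real where
  "bound = (\<Sum>i\<in>{-M..M}. \<kappa> i) + 3 * C"

lemma C_nonneg: "0 \<le> C"
  using decay[of 1 M "{}"] by simp

text \<open>
  The form of a tent is half the sum of \<open>k i j (h i - h j)\<^sup>2\<close>.  Pairs meeting the window
  \<open>{- M..M}\<close> contribute at most its row sums, because the increments are at most 1.  Among the other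
  pairs only those with an index in \<open>window R\<close> count; these are \<open>2R + 1\<close> rows, and the decay bounds
  each of them by \<open>C / R\<close>.
\<close>

lemma form_tent_le:
  assumes R: "1 \<le> R"
  shows "form (tent R) (tent R) \<le> bound"
proof -
  define h where "h = tent R"
  define w where "w i j = (min 1 (\<bar>i - j\<bar> / real R))\<^sup>2" for i j :: int
  have supp: "supp h \<subseteq> window L" if "R \<le> L" for L
    using tent_eq_0[of R] R window_mono[OF that] by (auto simp: h_def)
  have w: "(h i - h j)\<^sup>2 \<le> w i j" "w i j \<le> 1" "0 \<le> w i j" "w i j = w j i" for i j
    using tent_diff_square_le[of R i j] R
    by (auto simp: h_def w_def abs_minus_commute power_le_one)
  \<comment> \<open>Truncating the row sums to a larger window leaves finite sums, where the square can be completed.\<close>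
  have trunc: "(\<Sum>i\<in>window R. (h i)\<^sup>2 * (\<Sum>j\<in>window L. k i j))
      - (\<Sum>i\<in>window R. \<Sum>j\<in>window R. h i * h j * k i j) \<le> bound" if "R \<le> L" for L
  proof -
    let ?B = "window L"
    have zero: "h i = 0" if "i \<notin> window R" for i
      using tent_eq_0[OF _ that] R by (simp add: h_def)
    have e1: "(\<Sum>i\<in>window R. (h i)\<^sup>2 * (\<Sum>j\<in>?B. k i j)) = (\<Sum>i\<in>?B. (h i)\<^sup>2 * (\<Sum>j\<in>?B. k i j))"
      using window_mono[OF that] zero by (intro sum.mono_neutral_left) auto
    have e2: "(\<Sum>i\<in>window R. \<Sum>j\<in>window R. h i * h j * k i j) = (\<Sum>i\<in>?B. \<Sum>j\<in>?B. h i * h j * k i j)"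
      using window_mono[OF that] zero
      by (intro sum.mono_neutral_cong_left) (auto intro!: sum.mono_neutral_left)
    have e3: "(\<Sum>i\<in>?B. (h i)\<^sup>2 * (\<Sum>j\<in>?B. k i j)) = (\<Sum>i\<in>?B. \<Sum>j\<in>?B. (h j)\<^sup>2 * k i j)"
      by (subst sum.swap) (simp add: sum_distrib_left sym[of _ _])
    have e4: "(\<Sum>i\<in>?B. (h i)\<^sup>2 * (\<Sum>j\<in>?B. k i j)) = (\<Sum>i\<in>?B. \<Sum>j\<in>?B. (h i)\<^sup>2 * k i j)"
      by (simp add: sum_distrib_left)
    have e5: "(\<Sum>i\<in>?B. \<Sum>j\<in>?B. (h i - h j)\<^sup>2 * k i j)
       = (\<Sum>i\<in>?B. \<Sum>j\<in>?B. (h i)\<^sup>2 * k i j) + (\<Sum>i\<in>?B. \<Sum>j\<in>?B. (h j)\<^sup>2 * k i j)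
         - 2 * (\<Sum>i\<in>?B. \<Sum>j\<in>?B. h i * h j * k i j)"
      by (simp add: power2_diff algebra_simps sum.distrib sum_subtractf sum_distrib_left)
    have "2 * ((\<Sum>i\<in>window R. (h i)\<^sup>2 * (\<Sum>j\<in>?B. k i j)) - (\<Sum>i\<in>window R. \<Sum>j\<in>window R. h i * h j * k i j))
       = (\<Sum>i\<in>?B. (h i)\<^sup>2 * (\<Sum>j\<in>?B. k i j)) + (\<Sum>i\<in>?B. (h i)\<^sup>2 * (\<Sum>j\<in>?B. k i j))
         - 2 * (\<Sum>i\<in>?B. \<Sum>j\<in>?B. h i * h j * k i j)"
      unfolding e1 e2 by simp
    also have "\<dots> = (\<Sum>i\<in>?B. \<Sum>j\<in>?B. (h i)\<^sup>2 * k i j) + (\<Sum>i\<in>?B. \<Sum>j\<in>?B. (h j)\<^sup>2 * k i j)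
         - 2 * (\<Sum>i\<in>?B. \<Sum>j\<in>?B. h i * h j * k i j)"
      by (intro arg_cong2[where f = "(-)"] arg_cong2[where f = "(+)"] e3 e4 refl)
    also have "\<dots> = (\<Sum>i\<in>?B. \<Sum>j\<in>?B. (h i - h j)\<^sup>2 * k i j)"
      by (rule e5[symmetric])
    also have "\<dots> \<le> (\<Sum>i\<in>?B. \<Sum>j\<in>?B. (if i \<in> {-M..M} then k i j else 0) + (if j \<in> {-M..M} then k i j else 0)
        + ((if i \<in> window R \<and> M \<le> \<bar>i\<bar> \<and> M \<le> \<bar>j\<bar> then w i j * k i j else 0)
          + (if j \<in> window R \<and> M \<le> \<bar>i\<bar> \<and> M \<le> \<bar>j\<bar> then w i j * k i j else 0)))"
    proof (intro sum_mono)
      fix i j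
      have *: "(h i - h j)\<^sup>2 * k i j \<le> w i j * k i j" "w i j * k i j \<le> k i j" "0 \<le> w i j * k i j"
        using w[of i j] nonneg[of i j] by (auto intro: mult_right_mono simp: mult_left_le_one_le)
      have **: "(h i - h j)\<^sup>2 * k i j = 0" if "i \<notin> window R" "j \<notin> window R"
        using zero that by simp
      show "(h i - h j)\<^sup>2 * k i j \<le> (if i \<in> {-M..M} then k i j else 0) + (if j \<in> {-M..M} then k i j else 0)
        + ((if i \<in> window R \<and> M \<le> \<bar>i\<bar> \<and> M \<le> \<bar>j\<bar> then w i j * k i j else 0)
          + (if j \<in> window R \<and> M \<le> \<bar>i\<bar> \<and> M \<le> \<bar>j\<bar> then w i j * k i j else 0))"
      proof (cases "i \<in> {-M..M} \<or> j \<in> {-M..M}")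
        case True
        have "0 \<le> (if i \<in> window R \<and> M \<le> \<bar>i\<bar> \<and> M \<le> \<bar>j\<bar> then w i j * k i j else 0)
          + (if j \<in> window R \<and> M \<le> \<bar>i\<bar> \<and> M \<le> \<bar>j\<bar> then w i j * k i j else 0)"
          using *(3) by simp
        moreover have "k i j \<le> (if i \<in> {-M..M} then k i j else 0) + (if j \<in> {-M..M} then k i j else 0)"
          using True nonneg[of i j] by auto
        ultimately show ?thesis using *(1,2) by linarith
      next
        case False
        then have "M \<le> \<bar>i\<bar>" "M \<le> \<bar>j\<bar>" "i \<notin> {-M..M}" "j \<notin> {-M..M}" by auto
        then show ?thesis
          using *(1,3) ** by (cases "i \<in> window R"; cases "j \<in> window R")
            (auto simp del: atLeastAtMost_iff simp: mult.commute)
      qed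
    qed
    also have "\<dots> = 2 * (\<Sum>i\<in>?B. \<Sum>j\<in>?B. if i \<in> {-M..M} then k i j else 0)
      + 2 * (\<Sum>i\<in>?B. \<Sum>j\<in>?B. if i \<in> window R \<and> M \<le> \<bar>i\<bar> \<and> M \<le> \<bar>j\<bar> then w i j * k i j else 0)"
    proof -
      have "(\<Sum>i\<in>?B. \<Sum>j\<in>?B. if j \<in> {-M..M} then k i j else 0) = (\<Sum>i\<in>?B. \<Sum>j\<in>?B. if i \<in> {-M..M} then k i j else 0)"
        by (subst sum.swap) (intro sum.cong refl, simp add: sym)
      moreover have "(\<Sum>i\<in>?B. \<Sum>j\<in>?B. if j \<in> window R \<and> M \<le> \<bar>i\<bar> \<and> M \<le> \<bar>j\<bar> then w i j * k i j else 0)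
         = (\<Sum>i\<in>?B. \<Sum>j\<in>?B. if i \<in> window R \<and> M \<le> \<bar>i\<bar> \<and> M \<le> \<bar>j\<bar> then w i j * k i j else 0)"
        by (subst sum.swap) (intro sum.cong refl, use sym w(4) in auto)
      ultimately show ?thesis by (simp only: sum.distrib)
    qed
    also have "(\<Sum>i\<in>?B. \<Sum>j\<in>?B. if i \<in> {-M..M} then k i j else 0) \<le> (\<Sum>i\<in>{-M..M}. \<kappa> i)"
    proof -
      have "(\<Sum>i\<in>?B. \<Sum>j\<in>?B. if i \<in> {-M..M} then k i j else 0) \<le> (\<Sum>i\<in>?B. if i \<in> {-M..M} then \<kappa> i else 0)"
        by (intro sum_mono) (auto simp: row_sum_le)
      also have "\<dots> = (\<Sum>i\<in>?B \<inter> {-M..M}. \<kappa> i)"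
        by (simp add: sum.inter_restrict)
      also have "\<dots> \<le> (\<Sum>i\<in>{-M..M}. \<kappa> i)"
        by (intro sum_mono2) (auto simp: row_nonneg)
      finally show ?thesis .
    qed
    also have "(\<Sum>i\<in>?B. \<Sum>j\<in>?B. if i \<in> window R \<and> M \<le> \<bar>i\<bar> \<and> M \<le> \<bar>j\<bar> then w i j * k i j else 0) \<le> 3 * C"
    proof -
      have "(\<Sum>j\<in>?B. if i \<in> window R \<and> M \<le> \<bar>i\<bar> \<and> M \<le> \<bar>j\<bar> then w i j * k i j else 0)
         \<le> (if i \<in> window R then C / R else 0)" for i
      proof (cases "i \<in> window R \<and> M \<le> \<bar>i\<bar>")
        case True
        have "(\<Sum>j\<in>?B. if i \<in> window R \<and> M \<le> \<bar>i\<bar> \<and> M \<le> \<bar>j\<bar> then w i j * k i j else 0)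
           = (\<Sum>j\<in>?B \<inter> {j. M \<le> \<bar>j\<bar>}. w i j * k i j)"
          using True by (simp add: sum.inter_restrict)
        also have "\<dots> \<le> C / R"
          unfolding w_def by (rule decay) (use R True in auto)
        finally show ?thesis using True by simp
      next
        case False
        then have "(\<Sum>j\<in>?B. if i \<in> window R \<and> M \<le> \<bar>i\<bar> \<and> M \<le> \<bar>j\<bar> then w i j * k i j else 0) = 0"
          by (intro sum.neutral) auto
        then show ?thesis using C_nonneg by simp
      qed
      then have "(\<Sum>i\<in>?B. \<Sum>j\<in>?B. if i \<in> window R \<and> M \<le> \<bar>i\<bar> \<and> M \<le> \<bar>j\<bar> then w i j * k i j else 0)
         \<le> (\<Sum>i\<in>?B. if i \<in> window R then C / R else 0)"
        by (intro sum_mono)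
      also have "\<dots> = real (card (window R)) * (C / R)"
        using window_mono[OF that] by (simp add: sum.If_cases Int_absorb1 Int_commute)
      also have "\<dots> = (2 * real R + 1) * (C / R)"
        by (simp add: window_def)
      also have "\<dots> \<le> (3 * real R) * (C / R)"
        using R C_nonneg by (intro mult_right_mono) auto
      finally show ?thesis using R by simp
    qed
    finally show ?thesis by (simp add: bound_def)
  qed
  have "(\<lambda>L. (\<Sum>i\<in>window R. (h i)\<^sup>2 * (\<Sum>j\<in>window L. k i j)) - (\<Sum>i\<in>window R. \<Sum>j\<in>window R. h i * h j * k i j))
     \<longlonglongrightarrow> (\<Sum>i\<in>window R. (h i)\<^sup>2 * \<kappa> i) - (\<Sum>i\<in>window R. \<Sum>j\<in>window R. h i * h j * k i j)"
    by (intro tendsto_intros row)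
  then have "(\<Sum>i\<in>window R. (h i)\<^sup>2 * \<kappa> i) - (\<Sum>i\<in>window R. \<Sum>j\<in>window R. h i * h j * k i j) \<le> bound"
    by (rule tendsto_upperbound) (use trunc in \<open>auto intro: eventually_sequentiallyI[of R]\<close>)
  then show ?thesis
    unfolding h_def[symmetric] by (subst form_square_superset[OF _ supp[OF order_refl]]) simp_all
qed

lemma bound_nonneg: "0 \<le> bound"
  unfolding bound_def using C_nonneg row_nonneg by (simp add: sum_nonneg)

text \<open>
  Adding tents one at a time, each so wide that its form with the sum built so far is less than 1, makes
  the form of the sum grow linearly in the number of tents instead of quadratically.
\<close>

lemma sums_of_tents:
  fixes J N :: nat
  assumes "0 < J"
  shows "\<exists>g :: int \<Rightarrow> real. finite (supp g) \<and> form g g \<le> 2 * (bound + 1) * real N \<and>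
    (\<forall>i. real N * (1 - \<bar>i\<bar> / J) \<le> g i \<and> g i \<le> N)"
proof (induction N)
  case 0
  show ?case by (rule exI[of _ "\<lambda>i. 0"]) (simp add: form_def)
next
  case (Suc N)
  then obtain g :: "int \<Rightarrow> real" where g: "finite (supp g)" "form g g \<le> 2 * (bound + 1) * real N"
    "\<And>i. real N * (1 - \<bar>i\<bar> / J) \<le> g i" "\<And>i. g i \<le> N"
    by blast
  have "\<forall>\<^sub>F R in sequentially. form g (tent R) < 1"
    using tendsto_form_tent[OF g(1)] by (rule order_tendstoD) simp
  then have "\<forall>\<^sub>F R in sequentially. form g (tent R) < 1 \<and> J \<le> R"
    by (intro eventually_conj) (auto intro: eventually_ge_at_top)
  then obtain R where R: "form g (tent R) < 1" "J \<le> R"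
    using eventually_happens' sequentially_bot by blast
  have fin: "finite (supp (tent R))"
    using supp_tent[of R] assms R(2) finite_subset[OF _ finite_window[of R]] by simp
  have "form (\<lambda>i. g i + tent R i) (\<lambda>i. g i + tent R i) \<le> 2 * (bound + 1) * real (Suc N)"
  proof -
    have "form (tent R) (tent R) \<le> bound" using R(2) assms by (intro form_tent_le) simp
    then have "form g g + form (tent R) (tent R) + 2 * form g (tent R) \<le> 2 * (bound + 1) * real N + bound + 2"
      using R(1) g(2) by linarith
    also have "\<dots> \<le> 2 * (bound + 1) * real (Suc N)"
      using bound_nonneg by (simp add: distrib_left)
    finally show ?thesis unfolding form_add_square[OF g(1) fin] .
  qed
  moreover have "finite (supp (\<lambda>i. g i + tent R i))"
    by (rule finite_subset[OF _ finite_UnI[OF g(1) fin]]) auto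
  moreover have "real (Suc N) * (1 - \<bar>i\<bar> / J) \<le> g i + tent R i \<and> g i + tent R i \<le> Suc N" for i
  proof -
    have "real (Suc N) * (1 - \<bar>i\<bar> / J) = real N * (1 - \<bar>i\<bar> / J) + (1 - \<bar>i\<bar> / J)"
      by (simp add: distrib_right)
    then show ?thesis
      using g(3,4)[of i] tent_lower[OF assms R(2), of i] tent_le_1[of R i] by simp
  qed
  ultimately show ?case by (intro exI[of _ "\<lambda>i. g i + tent R i"] conjI allI) simp_all
qed

theorem cheap_cutoffs:
  "\<exists>f. \<forall>n. finite (supp (f n)) \<and> form (f n) (f n) \<le> (1/2) ^ n \<and>
    (\<forall>i. 1 - \<bar>i\<bar> / Suc n \<le> f n i \<and> f n i \<le> 1)"
proof (intro choice allI)
  fix n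
  \<comment> \<open>Dividing a sum of \<open>N\<close> tents by \<open>N\<close> brings the form down to \<open>2 (bound + 1) / N\<close>.\<close>
  obtain N :: nat where N: "2 * (bound + 1) * 2 ^ n < N"
    using reals_Archimedean2 by blast
  moreover have "0 \<le> 2 * (bound + 1) * 2 ^ n" using bound_nonneg by simp
  ultimately have N0: "0 < real N" by linarith
  obtain g :: "int \<Rightarrow> real" where g: "finite (supp g)" "form g g \<le> 2 * (bound + 1) * real N"
    "\<And>i. real N * (1 - \<bar>i\<bar> / Suc n) \<le> g i" "\<And>i. g i \<le> N"
    using sums_of_tents[of "Suc n" N] by blast
  define f where "f i = 1 / N * g i" for i
  have "form f f = (1 / real N)\<^sup>2 * form g g"
    unfolding f_def by (rule form_scale)
  also have "\<dots> \<le> (1 / real N)\<^sup>2 * (2 * (bound + 1) * real N)"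
    by (intro mult_left_mono g) auto
  also have "\<dots> = 2 * (bound + 1) / real N"
    using N0 by (simp add: power2_eq_square field_simps)
  also have "\<dots> \<le> (1/2) ^ n"
    using N N0 by (simp add: field_simps power_one_over)
  finally have "form f f \<le> (1/2) ^ n" .
  moreover have "finite (supp f)"
    by (rule finite_subset[OF _ g(1)]) (auto simp: f_def)
  moreover have "1 - \<bar>i\<bar> / Suc n \<le> f i" "f i \<le> 1" for i
    using g(3,4)[of i] N0 by (auto simp: f_def field_simps)
  ultimately show "\<exists>f. finite (supp f) \<and> form f f \<le> (1/2) ^ n \<and>
    (\<forall>i. 1 - \<bar>i\<bar> / Suc n \<le> f i \<and> f i \<le> 1)" by (intro exI[of _ f] conjI allI)
qed

end

section \<open>First and second moments of point counts\<close>

lemma kernel_det_1: "kernel_det K 1 q = K (q 0) (q 0)"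
  unfolding kernel_det_def by (subst det_single) auto

lemma kernel_det_2:
  "kernel_det K 2 q = K (q 0) (q 0) * K (q 1) (q 1) - K (q 0) (q 1) * K (q 1) (q 0)"
proof -
  let ?A = "Matrix.mat 2 2 (\<lambda>(i, j). K (q i) (q j))"
  have "Determinant.det ?A = (\<Sum>j<2. ?A $$ (0, j) * cofactor ?A 0 j)"
    by (rule laplace_expansion_row) auto
  also have "\<dots> = ?A $$ (0, 0) * cofactor ?A 0 0 + ?A $$ (0, 1) * cofactor ?A 0 1"
    by (simp add: numeral_2_eq_2)
  finally have "Determinant.det ?A = \<dots>" .
  moreover have "cofactor ?A 0 0 = K (q 1) (q 1)" "cofactor ?A 0 1 = - K (q 1) (q 0)"
    unfolding cofactor_def by (subst det_single; simp add: mat_delete_def)+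
  ultimately show ?thesis
    unfolding kernel_det_def by simp
qed

lemma PiM_nn_integral_1:
  assumes "f \<in> borel_measurable lborel"
  shows "(\<integral>\<^sup>+q. f (q 0) \<partial>PiM {..<1::nat} (\<lambda>_. lborel :: real measure)) = (\<integral>\<^sup>+x. f x \<partial>lborel)"
proof -
  interpret product_sigma_finite "\<lambda>_::nat. lborel :: real measure" ..
  have "{..<1::nat} = {0}" by auto
  then show ?thesis using product_nn_integral_singleton[of f 0] assms by simp
qed

lemma PiM_nn_integral_2:
  fixes f :: "real \<Rightarrow> real \<Rightarrow> ennreal"
  assumes [measurable]: "case_prod f \<in> borel_measurable (borel \<Otimes>\<^sub>M borel)"
  shows "(\<integral>\<^sup>+q. f (q 0) (q 1) \<partial>PiM {..<2::nat} (\<lambda>_. lborel)) = (\<integral>\<^sup>+x. \<integral>\<^sup>+y. f x y \<partial>lborel \<partial>lborel)"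
proof -
  interpret product_sigma_finite "\<lambda>_::nat. lborel :: real measure" ..
  have *: "{..<2::nat} = insert 1 {0}" by auto
  have [measurable]: "(\<lambda>q. q 0) \<in> measurable (PiM {1, 0::nat} (\<lambda>_. lborel)) borel"
    "(\<lambda>q. q 1) \<in> measurable (PiM {1, 0::nat} (\<lambda>_. lborel)) (borel :: real measure)"
    using measurable_component_singleton[of 0 "{1, 0::nat}" "\<lambda>_. lborel :: real measure"]
      measurable_component_singleton[of 1 "{1, 0::nat}" "\<lambda>_. lborel :: real measure"] by simp_all
  have "(\<integral>\<^sup>+q. f (q 0) (q 1) \<partial>PiM {..<2::nat} (\<lambda>_. lborel))
      = (\<integral>\<^sup>+q. (\<integral>\<^sup>+y. f ((q(1 := y)) 0) ((q(1 := y)) 1) \<partial>lborel) \<partial>PiM {0::nat} (\<lambda>_. lborel))"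
    unfolding * by (rule product_nn_integral_insert) (simp, simp, measurable)
  also have "\<dots> = (\<integral>\<^sup>+q. (\<integral>\<^sup>+y. f (q 0) y \<partial>lborel) \<partial>PiM {0::nat} (\<lambda>_. lborel))"
    by simp
  also have "\<dots> = (\<integral>\<^sup>+x. \<integral>\<^sup>+y. f x y \<partial>lborel \<partial>lborel)"
    by (rule product_nn_integral_singleton[of "\<lambda>x. \<integral>\<^sup>+y. f x y \<partial>lborel" 0]) measurable
  finally show ?thesis .
qed

lemma space_conf_space: "space conf_space = Conf"
  unfolding conf_space_def by (rule space_measure_of) auto

lemma sets_conf_spaceI:
  assumes "B \<in> sets borel" "bounded B"
  shows "{X \<in> Conf. card (X \<inter> B) = m} \<in> sets conf_space"
  unfolding conf_space_def by (rule in_measure_of) (use assms in auto)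

lemma measurable_count [measurable]:
  assumes "B \<in> sets borel" "bounded B"
  shows "(\<lambda>X. card (X \<inter> B)) \<in> measurable conf_space (count_space UNIV)"
proof -
  have "(\<lambda>X. card (X \<inter> B)) -` {m} \<inter> space conf_space = {X \<in> Conf. card (X \<inter> B) = m}" for m
    by (auto simp: space_conf_space)
  then show ?thesis
    using sets_conf_spaceI[OF assms] by (simp add: measurable_count_space_eq2_countable)
qed

lemma measurable_count_process:
  assumes "point_process P" "B \<in> sets borel" "bounded B"
  shows "(\<lambda>X. card (X \<inter> B)) \<in> measurable P (count_space UNIV)"
proof -
  have "sets P = sets conf_space" using assms(1) by (simp add: point_process_def)
  then show ?thesis
    using measurable_count[OF assms(2,3)] measurable_cong_sets by blast
qed

text \<open>
  If the classes of a partition separate the points of \<open>X\<close>, ordered pairs of distinct points are the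
  same as pairs of points from different classes.
\<close>

lemma card_square_partition:
  assumes "finite A" "finite X" "\<And>x. x \<in> X \<Longrightarrow> c x \<in> A" "inj_on c X"
  shows "(card X)\<^sup>2 = card X + (\<Sum>(a, b)\<in>{(a, b)\<in>A \<times> A. a \<noteq> b}. card {x\<in>X. c x = a} * card {x\<in>X. c x = b})"
proof -
  define N where "N a = card {x\<in>X. c x = a}" for a
  have NX: "(\<Sum>a\<in>A. N a) = card X"
  proof -
    have "(\<Sum>a\<in>A. N a) = card (\<Union>a\<in>A. {x\<in>X. c x = a})"
      unfolding N_def using assms(1,2) by (subst card_UN_disjoint) auto
    also have "(\<Union>a\<in>A. {x\<in>X. c x = a}) = X" using assms(3) by auto
    finally show ?thesis .
  qed
  have sq: "N a * N a = N a" for a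
  proof -
    have "N a \<le> 1"
      unfolding N_def using assms(2,4) by (auto simp: card_le_Suc0_iff_eq inj_on_def)
    then show ?thesis by (auto simp: le_Suc_eq)
  qed
  have diag: "(\<Sum>(a, b)\<in>{(a, b)\<in>A \<times> A. a = b}. N a * N b) = card X"
    unfolding NX[symmetric] by (intro sum.reindex_bij_witness[of _ "\<lambda>a. (a, a)" fst]) (auto simp: sq)
  have "(card X)\<^sup>2 = (\<Sum>(a, b)\<in>A \<times> A. N a * N b)"
    by (simp add: power2_eq_square NX[symmetric] sum_product sum.cartesian_product)
  also have "A \<times> A = {(a, b)\<in>A \<times> A. a = b} \<union> {(a, b)\<in>A \<times> A. a \<noteq> b}" by auto
  also have "(\<Sum>(a, b)\<in>\<dots>. N a * N b) = (\<Sum>(a, b)\<in>{(a, b)\<in>A \<times> A. a = b}. N a * N b) + (\<Sum>(a, b)\<in>{(a, b)\<in>A \<times> A. a \<noteq> b}. N a * N b)"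
    using assms(1) by (intro sum.union_disjoint) (auto intro: finite_subset[of _ "A \<times> A"])
  finally show ?thesis unfolding diag unfolding N_def .
qed

lemma eventually_inj_on_floor:
  fixes X :: "real set"
  assumes "finite X"
  shows "\<forall>\<^sub>F n in sequentially. inj_on (\<lambda>x. \<lfloor>real n * x\<rfloor>) X"
proof -
  have "\<forall>\<^sub>F n in sequentially. x \<noteq> y \<longrightarrow> \<lfloor>real n * x\<rfloor> \<noteq> \<lfloor>real n * y\<rfloor>" for x y :: real
  proof (cases "x = y")
    case False
    obtain N :: nat where N: "1 / \<bar>x - y\<bar> < N" using reals_Archimedean2 by blast
    show ?thesis
    proof (rule eventually_sequentiallyI[of N], rule impI, rule notI)
      fix n :: nat assume n: "N \<le> n" and eq: "\<lfloor>real n * x\<rfloor> = \<lfloor>real n * y\<rfloor>"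
      have "1 < real N * \<bar>x - y\<bar>" using N False by (simp add: field_simps)
      also have "\<dots> \<le> real n * \<bar>x - y\<bar>" using n by (intro mult_right_mono) auto
      also have "\<dots> = \<bar>real n * x - real n * y\<bar>" by (simp add: abs_mult flip: right_diff_distrib)
      finally show False using eq by linarith
    qed
  qed simp
  then have "\<forall>\<^sub>F n in sequentially. \<forall>(x, y)\<in>X \<times> X. x \<noteq> y \<longrightarrow> \<lfloor>real n * x\<rfloor> \<noteq> \<lfloor>real n * y\<rfloor>"
    using assms by (intro eventually_ball_finite) auto
  then show ?thesis by eventually_elim (auto simp: inj_on_def)
qed

text \<open>
  The correlation measure is only prescribed on products of disjoint sets.  Cutting \<open>B\<close> into pieces of
  length \<open>1/n\<close> eventually separates the points of a given configuration, so that pairs of distinct points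
  in \<open>B\<close> are counted by products over different pieces; these products are disjoint subsets of
  \<open>B \<times> B\<close>.  Fatou's lemma passes to the limit and yields an inequality, which is the direction needed to
  bound a variance from above.
\<close>

lemma second_moment_le:
  assumes P: "point_process P" and \<rho>: "correlation_measure P 2 \<rho>"
    and B: "B \<in> sets borel" "bounded B"
  shows "(\<integral>\<^sup>+X. (of_nat (card (X \<inter> B)))\<^sup>2 \<partial>P)
    \<le> (\<integral>\<^sup>+X. of_nat (card (X \<inter> B)) \<partial>P) + emeasure \<rho> (PiE {..<2} (\<lambda>_. B))"
proof -
  obtain c where c: "\<And>x. x \<in> B \<Longrightarrow> \<bar>x\<bar> \<le> c" using B(2) by (auto simp: bounded_real)
  define A where "A n = {\<lfloor>- real n * c\<rfloor>..\<lfloor>real n * c\<rfloor>}" for n :: nat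
  define U where "U n a = B \<inter> {x. \<lfloor>real n * x\<rfloor> = a}" for n :: nat and a
  define W where "W n = {(a, b)\<in>A n \<times> A n. a \<noteq> b}" for n
  have W: "finite (W n)" for n
    unfolding W_def by (rule finite_subset[of _ "A n \<times> A n"]) (auto simp: A_def)
  have inA: "\<lfloor>real n * x\<rfloor> \<in> A n" if "x \<in> B" for n x
  proof -
    have "- real n * c \<le> real n * x" "real n * x \<le> real n * c"
      using c[OF that] mult_left_mono[of "- c" x "real n"] mult_left_mono[of x c "real n"] by auto
    then show ?thesis by (auto simp: A_def intro: floor_mono)
  qed
  have U: "U n a \<in> sets borel" "bounded (U n a)" for n a
    using B by (auto simp: U_def intro: bounded_subset)
  have U_disj: "U n a \<inter> U n b = {}" if "a \<noteq> b" for n a b using that by (auto simp: U_def)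
  have X: "space P = Conf"
    using P by (metis point_process_def sets_eq_imp_space_eq space_conf_space)
  define S where "S n X = (of_nat (card (X \<inter> B)) +
     (\<Sum>(a, b)\<in>W n. of_nat (card (X \<inter> U n a)) * of_nat (card (X \<inter> U n b))) :: ennreal)" for n X
  have [measurable]: "(\<lambda>X. card (X \<inter> B)) \<in> measurable P (count_space UNIV)"
    "(\<lambda>X. card (X \<inter> U n a)) \<in> measurable P (count_space UNIV)" for n a
    by (intro measurable_count_process P B U)+
  have S_meas [measurable]: "S n \<in> borel_measurable P" for n
    unfolding S_def[abs_def] by measurable
  have ev: "\<forall>\<^sub>F n in sequentially. S n X = (of_nat (card (X \<inter> B)))\<^sup>2" if "X \<in> space P" for X
  proof -
    have fin: "finite (X \<inter> B)" using that B(2) by (auto simp: X Conf_def)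
    from eventually_inj_on_floor[OF this] show ?thesis
    proof eventually_elim
      case (elim n)
      have "{x\<in>X \<inter> B. \<lfloor>real n * x\<rfloor> = a} = X \<inter> U n a" for a by (auto simp: U_def)
      then have "(card (X \<inter> B))\<^sup>2 = card (X \<inter> B) + (\<Sum>(a, b)\<in>W n. card (X \<inter> U n a) * card (X \<inter> U n b))"
        using card_square_partition[of "A n", OF _ fin _ elim] inA by (simp add: A_def W_def)
      then have "of_nat ((card (X \<inter> B))\<^sup>2) = (of_nat (card (X \<inter> B) + (\<Sum>(a, b)\<in>W n. card (X \<inter> U n a) * card (X \<inter> U n b))) :: ennreal)"
        by (rule arg_cong)
      then show ?case by (simp add: S_def case_prod_beta)
    qed
  qed
  have "(\<integral>\<^sup>+X. (of_nat (card (X \<inter> B)))\<^sup>2 \<partial>P) = (\<integral>\<^sup>+X. liminf (\<lambda>n. S n X) \<partial>P)"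
  proof (rule nn_integral_cong)
    fix X assume "X \<in> space P"
    then have "(\<lambda>n. S n X) \<longlonglongrightarrow> (of_nat (card (X \<inter> B)))\<^sup>2" by (intro tendsto_eventually ev)
    then show "(of_nat (card (X \<inter> B)))\<^sup>2 = liminf (\<lambda>n. S n X)" by (intro lim_imp_Liminf[symmetric]) simp_all
  qed
  also have "\<dots> \<le> liminf (\<lambda>n. \<integral>\<^sup>+X. S n X \<partial>P)" by (rule nn_integral_liminf) measurable
  also have "\<dots> \<le> limsup (\<lambda>n. \<integral>\<^sup>+X. S n X \<partial>P)" by (rule Liminf_le_Limsup) simp
  also have "\<dots> \<le> (\<integral>\<^sup>+X. of_nat (card (X \<inter> B)) \<partial>P) + emeasure \<rho> (PiE {..<2} (\<lambda>_. B))"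
  proof (intro Limsup_bounded always_eventually allI)
    fix n
    define D where "D = (\<lambda>(a, b) i. if i = (0::nat) then U n a else U n b)"
    have "(\<integral>\<^sup>+X. S n X \<partial>P) = (\<integral>\<^sup>+X. of_nat (card (X \<inter> B)) \<partial>P) +
       (\<Sum>(a, b)\<in>W n. \<integral>\<^sup>+X. of_nat (card (X \<inter> U n a)) * of_nat (card (X \<inter> U n b)) \<partial>P)"
      unfolding S_def by (simp add: nn_integral_add nn_integral_sum case_prod_beta)
    also have "(\<Sum>(a, b)\<in>W n. \<integral>\<^sup>+X. of_nat (card (X \<inter> U n a)) * of_nat (card (X \<inter> U n b)) \<partial>P)
       = (\<Sum>p\<in>W n. emeasure \<rho> (PiE {..<2} (D p)))"
    proof (intro sum.cong refl, clarify)
      fix a b assume "(a, b) \<in> W n"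
      then have "disjoint_family_on (D (a, b)) {..<2}"
        using U_disj[of a b] U_disj[of b a] by (auto simp: disjoint_family_on_def D_def W_def)
      moreover have "\<forall>i<2. D (a, b) i \<in> sets borel \<and> bounded (D (a, b) i)"
        using U by (auto simp: D_def)
      ultimately have "(\<integral>\<^sup>+X. (\<Prod>i<2. of_nat (card (X \<inter> D (a, b) i))) \<partial>P) = emeasure \<rho> (PiE {..<2} (D (a, b)))"
        using \<rho> by (simp add: correlation_measure_def)
      then show "(\<integral>\<^sup>+X. of_nat (card (X \<inter> U n a)) * of_nat (card (X \<inter> U n b)) \<partial>P) = emeasure \<rho> (PiE {..<2} (D (a, b)))"
        by (simp add: numeral_2_eq_2 D_def)
    qed
    also have "\<dots> = emeasure \<rho> (\<Union>p\<in>W n. PiE {..<2} (D p))"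
    proof (rule sum_emeasure)
      show "(\<lambda>p. PiE {..<2} (D p)) ` W n \<subseteq> sets \<rho>"
        using \<rho> U by (auto simp: correlation_measure_def D_def intro!: sets_PiM_I_finite)
      show "disjoint_family_on (\<lambda>p. PiE {..<2} (D p)) (W n)"
        unfolding disjoint_family_on_def
      proof (intro ballI impI)
        fix p p' assume "p \<in> W n" "p' \<in> W n" "p \<noteq> p'"
        show "PiE {..<2} (D p) \<inter> PiE {..<2} (D p') = {}"
        proof (rule ccontr)
          assume "PiE {..<2} (D p) \<inter> PiE {..<2} (D p') \<noteq> {}"
          then obtain q where "q \<in> PiE {..<2} (D p)" "q \<in> PiE {..<2} (D p')" by auto
          then have "q 0 \<in> D p 0" "q 0 \<in> D p' 0" "q 1 \<in> D p 1" "q 1 \<in> D p' 1"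
            by (simp_all add: PiE_mem)
          then have "p = p'"
            by (cases p; cases p') (simp add: D_def U_def)
          with \<open>p \<noteq> p'\<close> show False ..
        qed
      qed
    qed (rule W)
    also have "\<dots> \<le> emeasure \<rho> (PiE {..<2} (\<lambda>_. B))"
    proof (rule emeasure_mono)
      show "PiE {..<2} (\<lambda>_. B) \<in> sets \<rho>"
        using \<rho> B by (auto simp: correlation_measure_def intro!: sets_PiM_I_finite)
      show "(\<Union>p\<in>W n. PiE {..<2} (D p)) \<subseteq> PiE {..<2} (\<lambda>_. B)"
        by (intro UN_least PiE_mono) (auto simp: D_def U_def split: prod.splits if_splits)
    qed
    finally show "(\<integral>\<^sup>+X. S n X \<partial>P) \<le> (\<integral>\<^sup>+X. of_nat (card (X \<inter> B)) \<partial>P) + emeasure \<rho> (PiE {..<2} (\<lambda>_. B))"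
      by (simp add: add_left_mono)
  qed
  finally show ?thesis .
qed

section \<open>The variance of the charge\<close>

text \<open>
  The origin is left out so that each cell lies in one open half-line.
\<close>

definition cell :: "int \<Rightarrow> real set" where
  "cell i = {x. \<lfloor>x\<rfloor> = i} - {0}"

definition side :: "int \<Rightarrow> real" where
  "side i = (if 0 \<le> i then 1 else - 1)"

lemma sets_cell [measurable, simp]: "cell i \<in> sets borel"
  unfolding cell_def by measurable

lemma cell_subset: "cell i \<subseteq> {real_of_int i..real_of_int i + 1}"
  by (auto simp: cell_def)

lemma bounded_cell [simp]: "bounded (cell i)"
  by (rule bounded_subset[OF bounded_closed_interval cell_subset])

lemma emeasure_cell_le: "emeasure lborel (cell i) \<le> 1"
proof -
  have "emeasure lborel (cell i) \<le> emeasure lborel {real_of_int i..real_of_int i + 1}"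
    by (intro emeasure_mono cell_subset) simp
  then show ?thesis by simp
qed

lemma cell_disjoint: "i \<noteq> j \<Longrightarrow> cell i \<inter> cell j = {}"
  by (auto simp: cell_def)

lemma cell_iff: "x \<in> cell i \<longleftrightarrow> x \<noteq> 0 \<and> \<lfloor>x\<rfloor> = i"
  by (auto simp: cell_def)

lemma sgn_cell: "x \<in> cell i \<Longrightarrow> sgn x = side i"
  by (auto simp: cell_iff side_def sgn_real_def)

lemma cell_half_line: "cell i \<subseteq> {0<..} \<or> cell i \<subseteq> {..<0}"
  by (auto simp: cell_iff) (smt (verit) zero_le_floor)

locale J_process =
  fixes K :: "real \<Rightarrow> real \<Rightarrow> complex" and P :: "real set measure"
  assumes herm: "J_hermitian K" and lyt: "lytvynov_condition K"
    and traces: "diagonal_gives_traces K" and det: "determinantal K P"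
begin

definition mass :: "int \<Rightarrow> real" where
  "mass i = (LINT x:cell i|lborel. Re (K x x))"

definition overlap :: "int \<Rightarrow> int \<Rightarrow> ennreal" where
  "overlap i j = (\<integral>\<^sup>+x. \<integral>\<^sup>+y. ennreal ((cmod (K x y))\<^sup>2) * indicator (cell i) x * indicator (cell j) y \<partial>lborel \<partial>lborel)"

definition pair_intensity :: "int \<Rightarrow> int \<Rightarrow> ennreal" where
  "pair_intensity i j = emeasure (det_measure K 2) (PiE {..<2} (\<lambda>n. if n = 0 then cell i else cell j))"

lemma measurable_K [measurable]: "case_prod K \<in> borel_measurable (borel \<Otimes>\<^sub>M borel)"
  using herm by (simp add: J_hermitian_def bounded_kernel_def borel_prod)

lemma measurable_K_comp [measurable]:
  assumes [measurable]: "f \<in> borel_measurable M" "g \<in> borel_measurable M"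
  shows "(\<lambda>x. K (f x) (g x)) \<in> borel_measurable M"
  using measurable_compose[OF measurable_Pair[OF assms] measurable_K] by simp

lemma K_swap: "x \<noteq> 0 \<Longrightarrow> y \<noteq> 0 \<Longrightarrow> K x y = of_real (sgn x) * of_real (sgn y) * cnj (K y x)"
  using herm unfolding J_hermitian_def by blast

lemma cmod_K_swap: "x \<noteq> 0 \<Longrightarrow> y \<noteq> 0 \<Longrightarrow> cmod (K x y) = cmod (K y x)"
  by (subst K_swap) (simp_all add: norm_mult)

lemma process: "point_process P"
  using det by (simp add: determinantal_def)

sublocale prob_space P
  using process by (simp add: point_process_def)

lemma correlation: "1 \<le> m \<Longrightarrow> correlation_measure P m (det_measure K m)"
  and det_nonneg: "1 \<le> m \<Longrightarrow> AE q in PiM {..<m} (\<lambda>_. lborel). kernel_det K m q \<in> \<real>\<^sub>\<ge>\<^sub>0"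
  using det by (auto simp: determinantal_def)

lemma measurable_coordinate:
  "i < m \<Longrightarrow> (\<lambda>q. q i) \<in> borel_measurable (PiM {..<m::nat} (\<lambda>_. lborel :: real measure))"
  using measurable_component_singleton[of i "{..<m}" "\<lambda>_. lborel :: real measure"] by simp

lemma diagonal_nonneg: "AE x in lborel. 0 \<le> Re (K x x)"
proof -
  have "(\<integral>\<^sup>+x. indicator {x. Re (K x x) < 0} x \<partial>lborel)
      = (\<integral>\<^sup>+q. indicator {x. Re (K x x) < 0} (q 0) \<partial>PiM {..<1::nat} (\<lambda>_. lborel))"
    by (rule PiM_nn_integral_1[symmetric]) measurable
  also have "\<dots> = (\<integral>\<^sup>+q. 0 \<partial>PiM {..<1::nat} (\<lambda>_. lborel :: real measure))"
    using det_nonneg[OF order_refl]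
  proof (intro nn_integral_cong_AE, eventually_elim)
    case (elim q)
    then show ?case unfolding kernel_det_1 by (auto simp: complex_nonneg_Reals_iff)
  qed
  finally have "(\<integral>\<^sup>+x. indicator {x. Re (K x x) < 0} x \<partial>lborel) = (0 :: ennreal)" by simp
  then have "AE x in lborel. indicator {x. Re (K x x) < 0} x = (0 :: ennreal)"
    by (rule nn_integral_0_iff_AE[THEN iffD1, rotated]) measurable
  then show ?thesis by eventually_elim (auto simp: indicator_def split: if_splits)
qed

lemma diagonal_nonneg_pair:
  "AE q in PiM {..<2::nat} (\<lambda>_. lborel). 0 \<le> Re (K (q 0) (q 0)) \<and> 0 \<le> Re (K (q 1) (q 1))"
proof -
  let ?M = "PiM {..<2::nat} (\<lambda>_. lborel :: real measure)"
  let ?N = "{x. Re (K x x) < 0}"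
  have [measurable]: "(\<lambda>q. q 0) \<in> borel_measurable ?M" "(\<lambda>q. q 1) \<in> borel_measurable ?M"
    using measurable_coordinate[of 0 2] measurable_coordinate[of 1 2] by simp_all
  have null: "AE x in lborel. indicator ?N x = (0 :: ennreal)"
    using diagonal_nonneg by eventually_elim (simp add: indicator_def)
  have zero: "(\<integral>\<^sup>+x. indicator ?N x \<partial>lborel) = 0"
    by (rule nn_integral_0_iff_AE[THEN iffD2, OF _ null]) measurable
  have "(\<integral>\<^sup>+q. indicator ?N (q 0) \<partial>?M) = (\<integral>\<^sup>+x. \<integral>\<^sup>+y. indicator ?N x \<partial>(lborel :: real measure) \<partial>lborel)"
    by (rule PiM_nn_integral_2[of "\<lambda>x y. indicator ?N x"]) measurable
  also have "\<dots> = (\<integral>\<^sup>+x. \<integral>\<^sup>+y. 0 \<partial>(lborel :: real measure) \<partial>(lborel :: real measure))"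
    using null by (intro nn_integral_cong_AE) (auto elim!: eventually_mono)
  finally have "(\<integral>\<^sup>+q. indicator ?N (q 0) \<partial>?M) = 0" by simp
  then have "AE q in ?M. indicator ?N (q 0) = (0 :: ennreal)"
    by (rule nn_integral_0_iff_AE[THEN iffD1, rotated]) measurable
  moreover have "(\<integral>\<^sup>+q. indicator ?N (q 1) \<partial>?M) = (\<integral>\<^sup>+x. \<integral>\<^sup>+y. indicator ?N y \<partial>lborel \<partial>(lborel :: real measure))"
    by (rule PiM_nn_integral_2[of "\<lambda>x y. indicator ?N y"]) measurable
  then have "(\<integral>\<^sup>+q. indicator ?N (q 1) \<partial>?M) = 0" unfolding zero by simp
  then have "AE q in ?M. indicator ?N (q 1) = (0 :: ennreal)"
    by (rule nn_integral_0_iff_AE[THEN iffD1, rotated]) measurable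
  ultimately show ?thesis by eventually_elim (auto simp: indicator_def split: if_splits)
qed

lemma diagonal_integrable: "set_integrable lborel (cell i) (\<lambda>x. Re (K x x))"
proof -
  have "set_integrable lborel (cell i) (\<lambda>x. K x x)"
    using traces cell_half_line[of i] sets_cell[of i] bounded_cell[of i]
    unfolding diagonal_gives_traces_def by blast
  then have "integrable lborel (\<lambda>x. Re (indicator (cell i) x *\<^sub>R K x x))"
    unfolding set_integrable_def by (rule integrable_Re)
  then show ?thesis by (simp add: set_integrable_def)
qed

lemma mass_nonneg: "0 \<le> mass i"
  unfolding mass_def set_lebesgue_integral_def
  using diagonal_nonneg by (intro integral_nonneg_AE) (auto elim!: eventually_mono)

lemma nn_integral_diagonal:
  "(\<integral>\<^sup>+x. ennreal (Re (K x x)) * indicator (cell i) x \<partial>lborel) = ennreal (mass i)"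
proof -
  have "(\<integral>\<^sup>+x. ennreal (Re (K x x)) * indicator (cell i) x \<partial>lborel)
      = (\<integral>\<^sup>+x. ennreal (indicator (cell i) x *\<^sub>R Re (K x x)) \<partial>lborel)"
    by (intro nn_integral_cong) (auto simp: indicator_def)
  also have "\<dots> = ennreal (mass i)"
    unfolding mass_def set_lebesgue_integral_def
    using diagonal_integrable[of i] diagonal_nonneg
    by (intro nn_integral_eq_integral) (auto simp: set_integrable_def elim!: eventually_mono)
  finally show ?thesis .
qed

lemma emeasure_det_measure:
  assumes [measurable]: "(\<lambda>q. kernel_det K m q) \<in> borel_measurable (PiM {..<m} (\<lambda>_. lborel))"
    and D: "\<And>i. i < m \<Longrightarrow> D i \<in> sets borel"
  shows "emeasure (det_measure K m) (PiE {..<m} D)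
    = (\<integral>\<^sup>+q. ennreal (Re (kernel_det K m q)) * indicator (PiE {..<m} D) q \<partial>PiM {..<m} (\<lambda>_. lborel))"
proof -
  have [measurable]: "PiE {..<m} D \<in> sets (PiM {..<m} (\<lambda>_. lborel))"
    using D by (auto intro!: sets_PiM_I_finite)
  show ?thesis unfolding det_measure_def by (rule emeasure_density) measurable
qed

lemma count_first_moment:
  "(\<integral>\<^sup>+X. of_nat (card (X \<inter> cell i)) \<partial>P) = ennreal (mass i)"
proof -
  have "(\<integral>\<^sup>+X. (\<Prod>n<1::nat. of_nat (card (X \<inter> cell i))) \<partial>P) = emeasure (det_measure K 1) (PiE {..<1} (\<lambda>_. cell i))"
    using correlation[OF order_refl] unfolding correlation_measure_def
    by (elim conjE allE[of _ "\<lambda>_::nat. cell i"]) (simp add: disjoint_family_on_def)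
  also have "\<dots> = (\<integral>\<^sup>+q. ennreal (Re (kernel_det K 1 q)) * indicator (PiE {..<1} (\<lambda>_. cell i)) q \<partial>PiM {..<1} (\<lambda>_. lborel))"
    by (rule emeasure_det_measure) (use measurable_coordinate[of 0 1] in \<open>simp_all add: kernel_det_1[abs_def, unfolded One_nat_def] kernel_det_1[abs_def]\<close>)
  also have "\<dots> = (\<integral>\<^sup>+q. ennreal (Re (K (q 0) (q 0))) * indicator (cell i) (q 0) \<partial>PiM {..<1::nat} (\<lambda>_. lborel))"
    by (intro nn_integral_cong) (auto simp: kernel_det_1 indicator_def PiE_iff space_PiM simp del: One_nat_def)
  also have "\<dots> = (\<integral>\<^sup>+x. ennreal (Re (K x x)) * indicator (cell i) x \<partial>lborel)"
    by (rule PiM_nn_integral_1) measurable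
  finally show ?thesis by (simp add: nn_integral_diagonal)
qed

lemma pair_moment:
  assumes "i \<noteq> j"
  shows "(\<integral>\<^sup>+X. of_nat (card (X \<inter> cell i)) * of_nat (card (X \<inter> cell j)) \<partial>P) = pair_intensity i j"
proof -
  define D where "D n = (if n = (0::nat) then cell i else cell j)" for n
  have "disjoint_family_on D {..<2}"
    using cell_disjoint[OF assms] by (auto simp: disjoint_family_on_def D_def)
  moreover have "\<forall>n<2. D n \<in> sets borel \<and> bounded (D n)" by (simp add: D_def)
  ultimately have "(\<integral>\<^sup>+X. (\<Prod>n<2. of_nat (card (X \<inter> D n))) \<partial>P) = emeasure (det_measure K 2) (PiE {..<2} D)"
    using correlation[of 2] by (simp add: correlation_measure_def)
  moreover have "D = (\<lambda>n. if n = 0 then cell i else cell j)" by (auto simp: D_def)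
  ultimately show ?thesis
    by (simp add: numeral_2_eq_2 pair_intensity_def)
qed

lemma square_moment_le:
  "(\<integral>\<^sup>+X. (of_nat (card (X \<inter> cell i)))\<^sup>2 \<partial>P) \<le> ennreal (mass i) + pair_intensity i i"
  using second_moment_le[OF process correlation[of 2], of "cell i"]
  by (simp add: count_first_moment pair_intensity_def)

text \<open>
  Integration of the determinant \<open>K(x,x) K(y,y) - sgn x sgn y \<bar>K(x,y)\<bar>\<^sup>2\<close>.  The overlap stands on
  the side on which it is added, because at this point it is not known to be finite and
  extended non-negative reals do not cancel.
\<close>

lemma pair_intensity_formula:
  "pair_intensity i j + (if side i = side j then overlap i j else 0)
    = ennreal (mass i * mass j) + (if side i = side j then 0 else overlap i j)"
proof -
  let ?M = "PiM {..<2::nat} (\<lambda>_. lborel :: real measure)"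
  let ?I = "\<lambda>q. indicator (cell i) (q 0) * indicator (cell j) (q 1) :: ennreal"
  have [measurable]: "(\<lambda>q. q 0) \<in> borel_measurable ?M" "(\<lambda>q. q 1) \<in> borel_measurable ?M"
    using measurable_coordinate[of 0 2] measurable_coordinate[of 1 2] by simp_all
  have mdet [measurable]: "(\<lambda>q. kernel_det K 2 q) \<in> borel_measurable ?M"
    unfolding kernel_det_2 by measurable
  have inten: "pair_intensity i j = (\<integral>\<^sup>+q. ennreal (Re (kernel_det K 2 q)) * ?I q \<partial>?M)"
  proof -
    have "pair_intensity i j = (\<integral>\<^sup>+q. ennreal (Re (kernel_det K 2 q)) *
        indicator (PiE {..<2} (\<lambda>n. if n = 0 then cell i else cell j)) q \<partial>?M)"
      unfolding pair_intensity_def by (rule emeasure_det_measure[OF mdet]) simp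
    also have "\<dots> = (\<integral>\<^sup>+q. ennreal (Re (kernel_det K 2 q)) * ?I q \<partial>?M)"
    proof (intro nn_integral_cong arg_cong2[where f = "(*)"] refl)
      fix q assume "q \<in> space ?M"
      then have "q \<in> PiE {..<2} (\<lambda>n. if n = 0 then cell i else cell j) \<longleftrightarrow> q 0 \<in> cell i \<and> q 1 \<in> cell j"
        by (auto simp: space_PiM PiE_iff less_2_cases_iff)
      then show "indicator (PiE {..<2} (\<lambda>n. if n = 0 then cell i else cell j)) q = ?I q"
        by (auto simp: indicator_def)
    qed
    finally show ?thesis .
  qed
  have over: "overlap i j = (\<integral>\<^sup>+q. ennreal ((cmod (K (q 0) (q 1)))\<^sup>2) * ?I q \<partial>?M)"
    unfolding overlap_def by (subst PiM_nn_integral_2[symmetric]) (measurable, simp add: mult.assoc)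
  have prod: "ennreal (mass i * mass j) = (\<integral>\<^sup>+q. ennreal (Re (K (q 0) (q 0)) * Re (K (q 1) (q 1))) * ?I q \<partial>?M)"
  proof -
    have "(\<integral>\<^sup>+q. ennreal (Re (K (q 0) (q 0)) * Re (K (q 1) (q 1))) * ?I q \<partial>?M)
        = (\<integral>\<^sup>+x. \<integral>\<^sup>+y. ennreal (Re (K x x) * Re (K y y)) * (indicator (cell i) x * indicator (cell j) y) \<partial>lborel \<partial>lborel)"
      by (rule PiM_nn_integral_2) measurable
    also have "\<dots> = (\<integral>\<^sup>+x. (ennreal (Re (K x x)) * indicator (cell i) x) *
        (\<integral>\<^sup>+y. ennreal (Re (K y y)) * indicator (cell j) y \<partial>lborel) \<partial>lborel)"
      using diagonal_nonneg
    proof (intro nn_integral_cong_AE, eventually_elim)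
      case (elim x)
      have "(\<integral>\<^sup>+y. ennreal (Re (K x x) * Re (K y y)) * (indicator (cell i) x * indicator (cell j) y) \<partial>lborel)
          = (\<integral>\<^sup>+y. (ennreal (Re (K x x)) * indicator (cell i) x) * (ennreal (Re (K y y)) * indicator (cell j) y) \<partial>lborel)"
        unfolding ennreal_mult'[OF elim(2)] by (simp only: mult_ac)
      then show ?case by (simp add: nn_integral_cmult)
    qed
    also have "\<dots> = ennreal (mass i) * ennreal (mass j)"
      by (simp add: nn_integral_diagonal nn_integral_multc)
    finally show ?thesis by (simp add: ennreal_mult mass_nonneg)
  qed
  have density: "Re (kernel_det K 2 q) = Re (K (q 0) (q 0)) * Re (K (q 1) (q 1)) - side i * side j * (cmod (K (q 0) (q 1)))\<^sup>2"
    if "q 0 \<in> cell i" "q 1 \<in> cell j" for q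
  proof -
    have nz: "q 0 \<noteq> 0" "q 1 \<noteq> 0" using that by (auto simp: cell_iff)
    have real: "Im (K x x) = 0" if "x \<noteq> 0" for x
      using arg_cong[OF K_swap[OF that that], of Im] that by (simp add: sgn_real_def split: if_splits)
    have "K (q 0) (q 1) * K (q 1) (q 0) = of_real (side i * side j * (cmod (K (q 0) (q 1)))\<^sup>2)"
      using that by (subst K_swap[OF nz(2,1)]) (simp add: sgn_cell complex_norm_square[symmetric] mult_ac)
    then show ?thesis unfolding kernel_det_2 by (simp add: real nz)
  qed
  show ?thesis
  proof (cases "side i = side j")
    case True
    then have ss: "side i * side j = 1" by (auto simp: side_def split: if_splits)
    have "pair_intensity i j + overlap i j = (\<integral>\<^sup>+q. ennreal (Re (kernel_det K 2 q)) * ?I q + ennreal ((cmod (K (q 0) (q 1)))\<^sup>2) * ?I q \<partial>?M)"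
      unfolding inten over by (rule nn_integral_add[symmetric]) measurable
    also have "\<dots> = (\<integral>\<^sup>+q. ennreal (Re (K (q 0) (q 0)) * Re (K (q 1) (q 1))) * ?I q \<partial>?M)"
    proof (intro nn_integral_cong_AE)
      show "AE q in ?M. ennreal (Re (kernel_det K 2 q)) * ?I q + ennreal ((cmod (K (q 0) (q 1)))\<^sup>2) * ?I q
          = ennreal (Re (K (q 0) (q 0)) * Re (K (q 1) (q 1))) * ?I q"
        using det_nonneg[of 2, simplified]
      proof eventually_elim
        case (elim q)
        show ?case
        proof (cases "q 0 \<in> cell i \<and> q 1 \<in> cell j")
          case True
          then have "Re (kernel_det K 2 q) + (cmod (K (q 0) (q 1)))\<^sup>2 = Re (K (q 0) (q 0)) * Re (K (q 1) (q 1))"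
            using density[of q] ss by simp
          moreover have "0 \<le> Re (kernel_det K 2 q)" using elim by (simp add: complex_nonneg_Reals_iff)
          ultimately show ?thesis using True by (simp flip: ennreal_plus)
        qed auto
      qed
    qed
    finally show ?thesis using True prod by simp
  next
    case False
    then have ss: "side i * side j = - 1" by (auto simp: side_def split: if_splits)
    have "pair_intensity i j = (\<integral>\<^sup>+q. ennreal (Re (K (q 0) (q 0)) * Re (K (q 1) (q 1))) * ?I q + ennreal ((cmod (K (q 0) (q 1)))\<^sup>2) * ?I q \<partial>?M)"
      unfolding inten
    proof (intro nn_integral_cong_AE)
      have nn: "AE q in ?M. 0 \<le> Re (K (q 0) (q 0)) * Re (K (q 1) (q 1)) \<or> \<not> (q 0 \<in> cell i \<and> q 1 \<in> cell j)"
        using diagonal_nonneg_pair by eventually_elim simp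
      then show "AE q in ?M. ennreal (Re (kernel_det K 2 q)) * ?I q
          = ennreal (Re (K (q 0) (q 0)) * Re (K (q 1) (q 1))) * ?I q + ennreal ((cmod (K (q 0) (q 1)))\<^sup>2) * ?I q"
      proof eventually_elim
        case (elim q)
        show ?case
        proof (cases "q 0 \<in> cell i \<and> q 1 \<in> cell j")
          case True
          then have "Re (kernel_det K 2 q) = Re (K (q 0) (q 0)) * Re (K (q 1) (q 1)) + (cmod (K (q 0) (q 1)))\<^sup>2"
            using density[of q] ss by simp
          then show ?thesis using True elim by (simp add: ennreal_plus)
        qed auto
      qed
    qed
    also have "\<dots> = ennreal (mass i * mass j) + overlap i j"
      unfolding prod over by (rule nn_integral_add) measurable
    finally show ?thesis using False by simp
  qed
qed

lemma pair_intensity_le: "side i = side j \<Longrightarrow> pair_intensity i j \<le> ennreal (mass i * mass j)"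
  using pair_intensity_formula[of i j] by (metis add.right_neutral add_increasing2 order_refl zero_le)

lemma square_moment_finite: "(\<integral>\<^sup>+X. (of_nat (card (X \<inter> cell i)))\<^sup>2 \<partial>P) < \<infinity>"
proof -
  have "(\<integral>\<^sup>+X. (of_nat (card (X \<inter> cell i)))\<^sup>2 \<partial>P) \<le> ennreal (mass i) + ennreal (mass i * mass i)"
    using square_moment_le pair_intensity_le[of i i] by (meson add_left_mono order_trans)
  also have "\<dots> < \<infinity>" by simp
  finally show ?thesis .
qed

lemma measurable_cell_count [measurable]:
  "(\<lambda>X. card (X \<inter> cell i)) \<in> measurable P (count_space UNIV)"
  by (rule measurable_count_process[OF process]) simp_all

text \<open>
  Within one half-line the determinant is at most \<open>K(x,x) K(y,y)\<close>, which controls the second moments of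
  single cells.  For distinct cells the mixed moment is bounded by the sum of the two.
\<close>

lemma pair_intensity_finite: "pair_intensity i j < \<infinity>"
proof (cases "i = j")
  case True
  then have "pair_intensity i j \<le> ennreal (mass i * mass j)" by (intro pair_intensity_le) simp
  then show ?thesis by (rule le_less_trans) simp
next
  case False
  have "of_nat a * of_nat b \<le> (of_nat a)\<^sup>2 + ((of_nat b)\<^sup>2 :: ennreal)" for a b :: nat
  proof -
    have "a * b \<le> a\<^sup>2 + b\<^sup>2"
      by (cases "a \<le> b") (auto simp: power2_eq_square intro: add_increasing add_increasing2 mult_mono)
    then have "of_nat (a * b) \<le> (of_nat (a\<^sup>2 + b\<^sup>2) :: ennreal)" by (rule of_nat_mono)
    then show ?thesis by simp
  qed
  then have "pair_intensity i j \<le> (\<integral>\<^sup>+X. (of_nat (card (X \<inter> cell i)))\<^sup>2 + (of_nat (card (X \<inter> cell j)))\<^sup>2 \<partial>P)"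
    unfolding pair_moment[OF False, symmetric] by (intro nn_integral_mono)
  also have "\<dots> < \<infinity>"
    using square_moment_finite[of i] square_moment_finite[of j] by (simp add: nn_integral_add)
  finally show ?thesis .
qed

definition coupling_weight :: "int \<Rightarrow> int \<Rightarrow> real" where
  "coupling_weight i j = enn2real (overlap i j)"

text \<open>
  On one side this is positivity of the determinant; across the origin the overlap is part of a finite
  mixed moment.
\<close>

lemma overlap_finite: "overlap i j < \<infinity>"
proof (cases "side i = side j")
  case True
  then have "overlap i j \<le> ennreal (mass i * mass j)"
    using pair_intensity_formula[of i j] by (metis add.commute add.right_neutral add_increasing2 order_refl zero_le)
  then show ?thesis by (rule le_less_trans) simp
next
  case False
  then have "overlap i j \<le> pair_intensity i j"
    using pair_intensity_formula[of i j] by (metis add.commute add.right_neutral add_increasing2 order_refl zero_le)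
  then show ?thesis using le_less_trans pair_intensity_finite by blast
qed

lemma ennreal_coupling_weight: "ennreal (coupling_weight i j) = overlap i j"
  using overlap_finite[of i j] by (simp add: coupling_weight_def)

lemma pair_intensity_eq:
  "pair_intensity i j = ennreal (mass i * mass j - side i * side j * coupling_weight i j)"
  "0 \<le> mass i * mass j - side i * side j * coupling_weight i j"
proof -
  obtain c where c: "0 \<le> c" "pair_intensity i j = ennreal c"
    using pair_intensity_finite[of i j] by (cases "pair_intensity i j") auto
  have k: "0 \<le> coupling_weight i j" by (simp add: coupling_weight_def)
  have "c = mass i * mass j - side i * side j * coupling_weight i j"
  proof (cases "side i = side j")
    case True
    then have "ennreal (c + coupling_weight i j) = ennreal (mass i * mass j)"
      using pair_intensity_formula[of i j] c k by (simp flip: ennreal_coupling_weight)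
    then have "c + coupling_weight i j = mass i * mass j"
      using c k mass_nonneg by (subst (asm) ennreal_inj) auto
    moreover have "side i * side j = 1" using True by (auto simp: side_def split: if_splits)
    ultimately show ?thesis by simp
  next
    case False
    then have "ennreal c = ennreal (mass i * mass j + coupling_weight i j)"
      using pair_intensity_formula[of i j] c k mass_nonneg
      by (simp flip: ennreal_coupling_weight)
    then have "c = mass i * mass j + coupling_weight i j"
      using c k mass_nonneg by (subst (asm) ennreal_inj) auto
    moreover have "side i * side j = - 1" using False by (auto simp: side_def split: if_splits)
    ultimately show ?thesis by simp
  qed
  with c show "pair_intensity i j = ennreal (mass i * mass j - side i * side j * coupling_weight i j)"
    "0 \<le> mass i * mass j - side i * side j * coupling_weight i j" by simp_all
qed

definition count :: "int \<Rightarrow> real set \<Rightarrow> real" where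
  "count i X = real (card (X \<inter> cell i))"

lemma measurable_count_real [measurable]: "count i \<in> borel_measurable P"
  unfolding count_def[abs_def] by measurable

lemma count_mean: "integrable P (count i)" "expectation (count i) = mass i"
proof -
  have "has_bochner_integral P (count i) (mass i)"
    using count_first_moment[of i]
    by (intro has_bochner_integral_nn_integral)
       (auto simp: count_def mass_nonneg ennreal_of_nat_eq_real_of_nat)
  then show "integrable P (count i)" "expectation (count i) = mass i"
    by (auto simp: has_bochner_integral_iff)
qed

lemma count_product:
  "integrable P (\<lambda>X. count i X * count j X)"
  "expectation (\<lambda>X. count i X * count j X)
     \<le> mass i * mass j - side i * side j * coupling_weight i j + (if i = j then mass i else 0)"
  "i \<noteq> j \<Longrightarrow> expectation (\<lambda>X. count i X * count j X) = mass i * mass j - side i * side j * coupling_weight i j"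
proof -
  have nn: "(\<integral>\<^sup>+X. ennreal (count i X * count j X) \<partial>P)
     = (\<integral>\<^sup>+X. of_nat (card (X \<inter> cell i)) * of_nat (card (X \<inter> cell j)) \<partial>P)"
    by (intro nn_integral_cong) (simp add: count_def ennreal_mult ennreal_of_nat_eq_real_of_nat)
  have le: "(\<integral>\<^sup>+X. ennreal (count i X * count j X) \<partial>P)
     \<le> ennreal (mass i * mass j - side i * side j * coupling_weight i j + (if i = j then mass i else 0))"
  proof (cases "i = j")
    case True
    have "ennreal (mass i) + ennreal (mass i * mass i - side i * side i * coupling_weight i i)
       = ennreal (mass i * mass i - side i * side i * coupling_weight i i + mass i)"
      using pair_intensity_eq(2)[of i i] mass_nonneg[of i] by (subst add.commute, subst ennreal_plus) auto
    then show ?thesis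
      using square_moment_le[of i] True unfolding nn pair_intensity_eq(1) by (simp add: power2_eq_square)
  next
    case False
    then show ?thesis unfolding nn pair_moment[OF False] pair_intensity_eq(1) by simp
  qed
  then show int: "integrable P (\<lambda>X. count i X * count j X)"
    by (intro integrableI_bounded) (auto simp: count_def intro: le_less_trans)
  have "ennreal (expectation (\<lambda>X. count i X * count j X)) = (\<integral>\<^sup>+X. ennreal (count i X * count j X) \<partial>P)"
    by (rule nn_integral_eq_integral[symmetric, OF int]) (simp add: count_def)
  note E = this
  have "0 \<le> mass i * mass j - side i * side j * coupling_weight i j + (if i = j then mass i else 0)"
    using pair_intensity_eq(2)[of i j] mass_nonneg by simp
  then show "expectation (\<lambda>X. count i X * count j X)
     \<le> mass i * mass j - side i * side j * coupling_weight i j + (if i = j then mass i else 0)"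
    using le unfolding E[symmetric] by (simp add: ennreal_le_iff)
  show "expectation (\<lambda>X. count i X * count j X) = mass i * mass j - side i * side j * coupling_weight i j" if "i \<noteq> j"
  proof -
    have "ennreal (expectation (\<lambda>X. count i X * count j X)) = ennreal (mass i * mass j - side i * side j * coupling_weight i j)"
      unfolding E nn pair_moment[OF that] pair_intensity_eq(1) ..
    moreover have "0 \<le> expectation (\<lambda>X. count i X * count j X)"
      by (rule Bochner_Integration.integral_nonneg) (simp add: count_def)
    ultimately show ?thesis using pair_intensity_eq(2)[of i j] by (subst (asm) ennreal_inj) auto
  qed
qed

lemma overlap_sym: "overlap i j = overlap j i"
proof -
  have "overlap i j = (\<integral>\<^sup>+y. \<integral>\<^sup>+x. ennreal ((cmod (K x y))\<^sup>2) * indicator (cell i) x * indicator (cell j) y \<partial>lborel \<partial>lborel)"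
    unfolding overlap_def by (rule lborel_pair.Fubini') measurable
  also have "\<dots> = overlap j i"
    unfolding overlap_def
    by (intro nn_integral_cong) (auto simp: indicator_def cell_iff cmod_K_swap)
  finally show ?thesis .
qed

text \<open>
  Finiteness of the overlaps with all cells, a countable family that covers almost every \<open>x\<close>.
\<close>

lemma rows_L2: "AE x in lborel. (\<lambda>y. indicator (cell i) y * cnj (K x y)) \<in> L2"
proof -
  have "AE x in lborel. (\<integral>\<^sup>+y. ennreal ((cmod (K x y))\<^sup>2) * indicator (cell j) x * indicator (cell i) y \<partial>lborel) \<noteq> \<infinity>" for j
    using overlap_finite[of j i] unfolding overlap_def by (intro nn_integral_PInf_AE) auto
  then have "AE x in lborel. \<forall>j. (\<integral>\<^sup>+y. ennreal ((cmod (K x y))\<^sup>2) * indicator (cell j) x * indicator (cell i) y \<partial>lborel) \<noteq> \<infinity>"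
    by (simp add: AE_all_countable)
  moreover have "AE x in lborel. x \<noteq> (0 :: real)" by (rule AE_lborel_singleton)
  ultimately show ?thesis
  proof eventually_elim
    case (elim x)
    have [measurable]: "(\<lambda>y. K x y) \<in> borel_measurable borel" by measurable
    have [measurable]: "(\<lambda>y. cnj (K x y)) \<in> borel_measurable borel"
      by (rule borel_measurable_continuous_on[where f = cnj]) (intro continuous_intros, measurable)
    have "x \<in> cell \<lfloor>x\<rfloor>" using elim(2) by (simp add: cell_iff)
    then have "(\<integral>\<^sup>+y. ennreal ((cmod (K x y))\<^sup>2) * indicator (cell i) y \<partial>lborel) \<noteq> \<infinity>"
      using elim(1)[rule_format, of "\<lfloor>x\<rfloor>"] by simp
    moreover have "(\<integral>\<^sup>+y. ennreal ((cmod (indicator (cell i) y * cnj (K x y)))\<^sup>2) \<partial>lborel)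
       = (\<integral>\<^sup>+y. ennreal ((cmod (K x y))\<^sup>2) * indicator (cell i) y \<partial>lborel)"
      by (intro nn_integral_cong) (auto simp: indicator_def)
    ultimately show ?case
      unfolding L2_iff_nn_integral by (simp add: less_top)
  qed
qed

text \<open>
  Summing the overlaps over all cells recovers the full squared norm of \<open>K\<close> over one cell, which is the
  trace of the compression to that cell.
\<close>

lemma coupling_rows: "(\<lambda>L. \<Sum>j\<in>window L. coupling_weight i j) \<longlonglongrightarrow> mass i"
proof -
  define F where "F x = (\<integral>\<^sup>+y. ennreal ((cmod (K x y))\<^sup>2) * indicator (cell i) y \<partial>lborel)" for x
  have [measurable]: "F \<in> borel_measurable lborel" unfolding F_def[abs_def] by measurable
  define \<mu> where "\<mu> = density lborel F"
  have \<mu>: "emeasure \<mu> A = (\<integral>\<^sup>+x. F x * indicator A x \<partial>lborel)" if "A \<in> sets borel" for A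
    unfolding \<mu>_def using that by (intro emeasure_density) auto
  have sets_\<mu>: "sets \<mu> = sets borel" by (simp add: \<mu>_def)
  have cells: "emeasure \<mu> (cell j) = overlap i j" for j
  proof -
    have "emeasure \<mu> (cell j) = overlap j i"
      unfolding \<mu>[OF sets_cell] overlap_def F_def
      by (intro nn_integral_cong) (auto simp: indicator_def)
    then show ?thesis by (simp add: overlap_sym)
  qed
  have "(\<lambda>L. emeasure \<mu> (\<Union>j\<in>window L. cell j)) \<longlonglongrightarrow> emeasure \<mu> (\<Union>L. \<Union>j\<in>window L. cell j)"
    by (rule Lim_emeasure_incseq) (auto simp: sets_\<mu> incseq_def dest: window_mono)
  moreover have "emeasure \<mu> (\<Union>j\<in>window L. cell j) = ennreal (\<Sum>j\<in>window L. coupling_weight i j)" for L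
  proof -
    have "emeasure \<mu> (\<Union>j\<in>window L. cell j) = (\<Sum>j\<in>window L. emeasure \<mu> (cell j))"
      by (rule sum_emeasure[symmetric]) (auto simp: sets_\<mu> disjoint_family_on_def cell_iff)
    also have "\<dots> = (\<Sum>j\<in>window L. ennreal (coupling_weight i j))"
      by (simp only: cells ennreal_coupling_weight)
    also have "\<dots> = ennreal (\<Sum>j\<in>window L. coupling_weight i j)"
      by (rule sum_ennreal) (simp add: coupling_weight_def)
    finally show ?thesis .
  qed
  moreover have "emeasure \<mu> (\<Union>L. \<Union>j\<in>window L. cell j) = ennreal (mass i)"
  proof -
    have "(\<Union>L. \<Union>j\<in>window L. cell j) = - {0}"
    proof -
      have "\<exists>L. \<lfloor>x\<rfloor> \<in> window L" for x :: real
        by (rule exI[of _ "nat \<bar>\<lfloor>x\<rfloor>\<bar>"]) (auto simp: window_def)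
      then show ?thesis by (auto simp: cell_iff)
    qed
    then have "emeasure \<mu> (\<Union>L. \<Union>j\<in>window L. cell j) = (\<integral>\<^sup>+x. F x * indicator (- {0}) x \<partial>lborel)"
      by (simp add: \<mu>)
    also have "\<dots> = (\<integral>\<^sup>+x. F x \<partial>lborel)"
      using AE_lborel_singleton[of "0 :: real"]
      by (intro nn_integral_cong_AE) (auto elim!: eventually_mono)
    also have "\<dots> = ennreal (mass i)"
      unfolding F_def mass_def
      by (rule trace_eq_Hilbert_Schmidt_norm[OF lyt traces]) (simp_all add: cell_half_line rows_L2)
    finally show ?thesis .
  qed
  ultimately have "(\<lambda>L. ennreal (\<Sum>j\<in>window L. coupling_weight i j)) \<longlonglongrightarrow> ennreal (mass i)" by simp
  then show ?thesis
    by (subst (asm) tendsto_ennreal_iff) (auto intro!: sum_nonneg always_eventually simp: mass_nonneg coupling_weight_def)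
qed

sublocale coupling coupling_weight mass
proof
  show "0 \<le> coupling_weight i j" for i j by (simp add: coupling_weight_def)
  show "coupling_weight i j = coupling_weight j i" for i j
    by (simp add: coupling_weight_def overlap_sym[of i j])
qed (rule coupling_rows)

definition charge :: "(int \<Rightarrow> real) \<Rightarrow> real set \<Rightarrow> real" where
  "charge f X = (\<Sum>i\<in>supp f. f i * side i * count i X)"

definition mean_charge :: "(int \<Rightarrow> real) \<Rightarrow> real" where
  "mean_charge f = (\<Sum>i\<in>supp f. f i * side i * mass i)"

text \<open>
  Weighting by \<open>side\<close> turns the covariances \<open>- side i * side j * coupling_weight i j\<close> of distinct
  cells into \<open>- coupling_weight i j\<close>, so the variance is at most the Dirichlet form.
\<close>

lemma charge_variance:
  assumes fin: "finite (supp f)"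
  shows "(\<integral>\<^sup>+X. ennreal ((charge f X - mean_charge f)\<^sup>2) \<partial>P) \<le> ennreal (form f f)"
proof -
  let ?A = "supp f"
  define b where "b i = f i * side i" for i
  define E2 where "E2 i j = expectation (\<lambda>X. count i X * count j X)" for i j
  have sq: "(charge f X - mean_charge f)\<^sup>2 = (\<Sum>i\<in>?A. \<Sum>j\<in>?A. b i * b j * (count i X * count j X))
      - 2 * mean_charge f * (\<Sum>i\<in>?A. b i * count i X) + (mean_charge f)\<^sup>2" for X
    by (simp add: charge_def b_def power2_diff power2_eq_square sum_product algebra_simps)
  have int2: "integrable P (\<lambda>X. \<Sum>i\<in>?A. \<Sum>j\<in>?A. b i * b j * (count i X * count j X))"
    by (intro Bochner_Integration.integrable_sum integrable_mult_right count_product)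
  have int1: "integrable P (\<lambda>X. 2 * mean_charge f * (\<Sum>i\<in>?A. b i * count i X))"
    by (intro Bochner_Integration.integrable_sum integrable_mult_right count_mean)
  have int: "integrable P (\<lambda>X. (charge f X - mean_charge f)\<^sup>2)"
    unfolding sq by (intro Bochner_Integration.integrable_add Bochner_Integration.integrable_diff int1 int2) simp
  have "expectation (\<lambda>X. (charge f X - mean_charge f)\<^sup>2)
     = (\<Sum>i\<in>?A. \<Sum>j\<in>?A. b i * b j * E2 i j) - 2 * mean_charge f * (\<Sum>i\<in>?A. b i * mass i) + (mean_charge f)\<^sup>2"
  proof -
    have "expectation (\<lambda>X. (charge f X - mean_charge f)\<^sup>2)
      = expectation (\<lambda>X. \<Sum>i\<in>?A. \<Sum>j\<in>?A. b i * b j * (count i X * count j X))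
        - expectation (\<lambda>X. 2 * mean_charge f * (\<Sum>i\<in>?A. b i * count i X)) + (mean_charge f)\<^sup>2"
      unfolding sq using int1 int2 by (simp add: prob_space)
    also have "expectation (\<lambda>X. \<Sum>i\<in>?A. \<Sum>j\<in>?A. b i * b j * (count i X * count j X)) = (\<Sum>i\<in>?A. \<Sum>j\<in>?A. b i * b j * E2 i j)"
      by (simp add: Bochner_Integration.integral_sum count_product E2_def)
    also have "expectation (\<lambda>X. 2 * mean_charge f * (\<Sum>i\<in>?A. b i * count i X)) = 2 * mean_charge f * (\<Sum>i\<in>?A. b i * mass i)"
      by (simp add: Bochner_Integration.integral_sum count_mean)
    finally show ?thesis .
  qed
  also have "\<dots> = (\<Sum>i\<in>?A. \<Sum>j\<in>?A. b i * b j * (E2 i j - mass i * mass j))"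
  proof -
    have mc: "mean_charge f = (\<Sum>i\<in>?A. b i * mass i)" by (simp add: mean_charge_def b_def)
    then have "(mean_charge f)\<^sup>2 = (\<Sum>i\<in>?A. \<Sum>j\<in>?A. b i * b j * (mass i * mass j))"
      by (simp add: power2_eq_square sum_product mult_ac)
    moreover have "(\<Sum>i\<in>?A. \<Sum>j\<in>?A. b i * b j * (E2 i j - mass i * mass j))
       = (\<Sum>i\<in>?A. \<Sum>j\<in>?A. b i * b j * E2 i j) - (\<Sum>i\<in>?A. \<Sum>j\<in>?A. b i * b j * (mass i * mass j))"
      by (simp add: right_diff_distrib sum_subtractf)
    ultimately show ?thesis unfolding mc[symmetric] by (simp add: power2_eq_square)
  qed
  also have "\<dots> \<le> (\<Sum>i\<in>?A. \<Sum>j\<in>?A. (if i = j then (f i)\<^sup>2 * mass i else 0) - f i * f j * coupling_weight i j)"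
  proof (intro sum_mono)
    fix i j
    have side: "side i * side i = 1" "side j * side j = 1" by (simp_all add: side_def)
    show "b i * b j * (E2 i j - mass i * mass j) \<le> (if i = j then (f i)\<^sup>2 * mass i else 0) - f i * f j * coupling_weight i j"
    proof (cases "i = j")
      case True
      have "b i * b i = (f i)\<^sup>2" using side by (simp add: b_def power2_eq_square algebra_simps)
      moreover have "E2 i i - mass i * mass i \<le> mass i - coupling_weight i i"
        using count_product(2)[of i i] side by (simp add: E2_def)
      then have "(f i)\<^sup>2 * (E2 i i - mass i * mass i) \<le> (f i)\<^sup>2 * (mass i - coupling_weight i i)"
        by (intro mult_left_mono) auto
      ultimately show ?thesis using True by (simp add: power2_eq_square algebra_simps)
    next
      case False
      have "b i * b j * (E2 i j - mass i * mass j) = - (f i * f j * (side i * side i) * (side j * side j) * coupling_weight i j)"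
        using count_product(3)[OF False] by (simp add: E2_def b_def)
      then show ?thesis using False side by simp
    qed
  qed
  also have "\<dots> = form f f"
    unfolding form_square_superset[OF fin order_refl] using fin by (simp add: sum_subtractf)
  finally have "expectation (\<lambda>X. (charge f X - mean_charge f)\<^sup>2) \<le> form f f" .
  then show ?thesis
    by (subst nn_integral_eq_integral[OF int]) (auto intro: ennreal_leI)
qed

end

section \<open>Decay of the coupling\<close>

text \<open>
  Summation by parts: \<open>min R (\<bar>t\<bar> + 1)\<close> squared is at most the sum of the odd numbers \<open>2s + 1\<close> over
  those \<open>s < R\<close> with \<open>s \<le> \<bar>t\<bar> + 1\<close>.  Each \<open>s\<close> contributes a tail of order \<open>1/s\<close>, so the total
  is of order \<open>R\<close>, and it is divided by \<open>R\<^sup>2\<close>.  The shift by 1 allows for the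
  difference between distances of points and distances of their cells.
\<close>

lemma weighted_tail_bound:
  fixes \<Phi> :: "real \<Rightarrow> real"
  assumes nn: "\<And>t. 0 \<le> \<Phi> t" and int: "integrable lborel \<Phi>"
    and tail: "(\<lambda>R. LINT t:{t. R \<le> \<bar>t\<bar>}|lborel. \<Phi> t) \<in> O[at_top](\<lambda>R. 1 / R)"
  obtains C where "0 \<le> C"
    "\<And>R::nat. (1::nat) \<le> R \<Longrightarrow> (\<integral>\<^sup>+t. ennreal (\<Phi> t * (min 1 ((\<bar>t\<bar> + 1) / R))\<^sup>2) \<partial>lborel) \<le> ennreal (C / R)"
proof -
  have [measurable]: "\<Phi> \<in> borel_measurable borel" using int by auto
  define T where "T s = (LINT t:{t. s \<le> \<bar>t\<bar>}|lborel. \<Phi> t)" for s :: real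
  define m where "m = (LINT t|lborel. \<Phi> t)"
  have m: "0 \<le> m" unfolding m_def by (simp add: nn Bochner_Integration.integral_nonneg)
  have Tint: "integrable lborel (\<lambda>t. indicator {t. s \<le> \<bar>t\<bar>} t *\<^sub>R \<Phi> t)" for s :: real
    by (rule Bochner_Integration.integrable_bound[OF int]) (auto simp: indicator_def)
  have Tnn: "0 \<le> T s" for s
    unfolding T_def set_lebesgue_integral_def by (simp add: nn Bochner_Integration.integral_nonneg)
  have Tm: "T s \<le> m" for s
    unfolding T_def m_def set_lebesgue_integral_def
    by (rule integral_mono[OF Tint int]) (auto simp: indicator_def nn)
  obtain c where c: "0 < c" "\<forall>\<^sub>F R in at_top. norm (T R) \<le> c * norm (1 / R)"
    using landau_o.bigE[OF tail] unfolding T_def by blast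
  then obtain R0 where R0: "\<And>R. R0 \<le> R \<Longrightarrow> norm (T R) \<le> c * norm (1 / R)"
    by (auto simp: eventually_at_top_linorder)
  define r where "r = max R0 1"
  \<comment> \<open>The first summand serves large \<open>s\<close>, where \<open>s + 1 \<le> 3 (s - 1)\<close>; the second serves \<open>s < r + 1\<close>.\<close>
  define C0 where "C0 = 3 * c + m * (r + 3)"
  have C0: "0 \<le> C0" using c m by (simp add: C0_def r_def)
  have bound: "T (real s - 1) \<le> C0 / (s + 1)" for s :: nat
  proof (cases "r + 1 \<le> s")
    case True
    then have s: "R0 \<le> real s - 1" "1 \<le> real s - 1" by (auto simp: r_def)
    then have "T (real s - 1) \<le> c * (1 / (real s - 1))" using R0[OF s(1)] by simp
    also have "\<dots> \<le> c * (3 / (real s + 1))"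
      using c s by (intro mult_left_mono) (auto simp: field_simps)
    also have "\<dots> \<le> C0 / (s + 1)"
      using m by (auto simp: C0_def r_def field_simps)
    finally show ?thesis .
  next
    case False
    then have "m * (real s + 1) \<le> m * (r + 3)" using m by (intro mult_left_mono) auto
    also have "\<dots> \<le> C0" using c by (simp add: C0_def)
    finally have "m \<le> C0 / (s + 1)" by (simp add: field_simps)
    then show ?thesis using Tm[of "real s - 1"] by linarith
  qed
  have squares: "(min (real R) (\<bar>t\<bar> + 1))\<^sup>2 \<le> (\<Sum>s<R. (2 * real s + 1) * indicator {t. real s - 1 \<le> \<bar>t\<bar>} t)" for R :: nat and t
  proof -
    define q where "q = min R (nat \<lfloor>\<bar>t\<bar> + 1\<rfloor> + 1)"
    have odd: "(\<Sum>s<q. 2 * real s + 1) = (real q)\<^sup>2" for q :: nat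
      by (induction q) (auto simp: power2_eq_square algebra_simps)
    have "min (real R) (\<bar>t\<bar> + 1) \<le> real q"
      unfolding q_def by (simp add: min_def) linarith
    then have "(min (real R) (\<bar>t\<bar> + 1))\<^sup>2 \<le> (real q)\<^sup>2"
      by (intro power_mono) auto
    also have "\<dots> = (\<Sum>s<q. (2 * real s + 1) * indicator {t. real s - 1 \<le> \<bar>t\<bar>} t)"
      unfolding odd[symmetric]
    proof (intro sum.cong refl)
      fix s assume "s \<in> {..<q}"
      then have "real s - 1 \<le> \<bar>t\<bar>" unfolding q_def by auto linarith
      then show "2 * real s + 1 = (2 * real s + 1) * indicator {t. real s - 1 \<le> \<bar>t\<bar>} t" by simp
    qed
    also have "\<dots> \<le> (\<Sum>s<R. (2 * real s + 1) * indicator {t. real s - 1 \<le> \<bar>t\<bar>} t)"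
      by (intro sum_mono2) (auto simp: q_def)
    finally show ?thesis .
  qed
  show thesis
  proof (rule that[of "2 * C0"])
    fix R :: nat assume R: "1 \<le> R"
    have "(\<integral>\<^sup>+t. ennreal (\<Phi> t * (min 1 ((\<bar>t\<bar> + 1) / R))\<^sup>2) \<partial>lborel)
       \<le> (\<integral>\<^sup>+t. ennreal (\<Sum>s<R. (1 / (real R)\<^sup>2 * (2 * real s + 1)) * (indicator {t. real s - 1 \<le> \<bar>t\<bar>} t *\<^sub>R \<Phi> t)) \<partial>lborel)"
    proof (intro nn_integral_mono ennreal_leI)
      fix t
      have "min 1 ((\<bar>t\<bar> + 1) / R) = min (real R) (\<bar>t\<bar> + 1) / R"
        using R by (simp add: min_def field_simps)
      then have "\<Phi> t * (min 1 ((\<bar>t\<bar> + 1) / R))\<^sup>2 = (1 / (real R)\<^sup>2 * \<Phi> t) * (min (real R) (\<bar>t\<bar> + 1))\<^sup>2"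
        by (simp add: power_divide)
      also have "\<dots> \<le> (1 / (real R)\<^sup>2 * \<Phi> t) * (\<Sum>s<R. (2 * real s + 1) * indicator {t. real s - 1 \<le> \<bar>t\<bar>} t)"
        by (intro mult_left_mono squares) (simp add: nn)
      also have "\<dots> = (\<Sum>s<R. (1 / (real R)\<^sup>2 * (2 * real s + 1)) * (indicator {t. real s - 1 \<le> \<bar>t\<bar>} t *\<^sub>R \<Phi> t))"
        unfolding sum_distrib_left by (intro sum.cong refl) (simp add: mult_ac)
      finally show "\<Phi> t * (min 1 ((\<bar>t\<bar> + 1) / R))\<^sup>2 \<le> \<dots>" .
    qed
    also have "\<dots> = ennreal (LINT t|lborel. (\<Sum>s<R. (1 / (real R)\<^sup>2 * (2 * real s + 1)) * (indicator {t. real s - 1 \<le> \<bar>t\<bar>} t *\<^sub>R \<Phi> t)))"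
      by (intro nn_integral_eq_integral Bochner_Integration.integrable_sum integrable_mult_right Tint)
         (auto intro!: sum_nonneg simp: nn)
    also have "(LINT t|lborel. (\<Sum>s<R. (1 / (real R)\<^sup>2 * (2 * real s + 1)) * (indicator {t. real s - 1 \<le> \<bar>t\<bar>} t *\<^sub>R \<Phi> t)))
       = (\<Sum>s<R. (1 / (real R)\<^sup>2 * (2 * real s + 1)) * T (real s - 1))"
      unfolding T_def set_lebesgue_integral_def
      by (rule trans[OF Bochner_Integration.integral_sum[OF integrable_mult_right[OF Tint]]])
         (intro sum.cong refl integral_mult_right_zero)
    also have "\<dots> \<le> (\<Sum>s<R. 1 / (real R)\<^sup>2 * (2 * C0))"
    proof (intro sum_mono)
      fix s
      have "(2 * real s + 1) * T (real s - 1) \<le> (2 * real s + 2) * (C0 / (s + 1))"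
        using bound[of s] Tnn by (intro mult_mono) auto
      also have "\<dots> = 2 * C0" by (simp add: field_simps)
      finally show "1 / (real R)\<^sup>2 * (2 * real s + 1) * T (real s - 1) \<le> 1 / (real R)\<^sup>2 * (2 * C0)"
        by (simp add: divide_right_mono)
    qed
    also have "\<dots> = 2 * C0 / R" using R by (simp add: power2_eq_square)
    finally show "(\<integral>\<^sup>+t. ennreal (\<Phi> t * (min 1 ((\<bar>t\<bar> + 1) / R))\<^sup>2) \<partial>lborel) \<le> ennreal (2 * C0 / R)"
      by (simp add: ennreal_leI)
  qed (use C0 in simp)
qed

lemma floor_diff_le: "x \<in> cell i \<Longrightarrow> y \<in> cell j \<Longrightarrow> real_of_int \<bar>i - j\<bar> \<le> \<bar>x - y\<bar> + 1"
  by (auto simp: cell_iff) linarith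

lemma cell_far: "x \<in> cell i \<Longrightarrow> real_of_int \<bar>i\<bar> - 1 \<le> \<bar>x\<bar>"
  by (auto simp: cell_iff) linarith

lemma sum_indicator_cell_le: "finite J \<Longrightarrow> (\<Sum>j\<in>J. indicator (cell j) y) \<le> (1 :: ennreal)"
proof -
  assume J: "finite J"
  have "(\<Sum>j\<in>J. indicator (cell j) y) = (indicator (\<Union>j\<in>J. cell j) y :: ennreal)"
    by (rule indicator_UN_disjoint[symmetric]) (use J in \<open>auto simp: disjoint_family_on_def cell_iff\<close>)
  then show ?thesis by (simp add: indicator_def)
qed

context J_process
begin

text \<open>
  The weight \<open>(min 1 (\<bar>i - j\<bar> / R))\<^sup>2\<close> is dominated by the same expression in \<open>\<bar>x - y\<bar> + 1\<close> for
  points of the two cells, so the sum over \<open>j\<close> is at most one translation-invariant integral over the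
  whole line, times the length of the cell \<open>i\<close>.
\<close>

lemma coupling_decays:
  assumes dec: "decay_condition K"
  obtains M C where "decaying_coupling coupling_weight mass M C"
proof -
  obtain M \<Phi> where nn: "\<And>t. 0 \<le> \<Phi> t" and int: "integrable lborel \<Phi>"
    and tail: "(\<lambda>R. LINT t:{t. R \<le> \<bar>t\<bar>}|lborel. \<Phi> t) \<in> O[at_top](\<lambda>R. 1 / R)"
    and K\<Phi>: "\<And>x y. M \<le> \<bar>x\<bar> \<Longrightarrow> M \<le> \<bar>y\<bar> \<Longrightarrow> (cmod (K x y))\<^sup>2 \<le> \<Phi> (x - y)"
    using dec unfolding decay_condition_def by blast
  obtain C where C: "0 \<le> C"
    "\<And>R::nat. (1::nat) \<le> R \<Longrightarrow> (\<integral>\<^sup>+t. ennreal (\<Phi> t * (min 1 ((\<bar>t\<bar> + 1) / R))\<^sup>2) \<partial>lborel) \<le> ennreal (C / R)"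
    using weighted_tail_bound[OF nn int tail] by blast
  have [measurable]: "\<Phi> \<in> borel_measurable borel" using int by auto
  \<comment> \<open>A cell with index of modulus at least \<open>\<lceil>M\<rceil> + 1\<close> lies outside \<open>{- M<..<M}\<close>.\<close>
  have "decaying_coupling coupling_weight mass (\<lceil>M\<rceil> + 1) C"
  proof
    fix R :: nat and i :: int and J :: "int set"
    assume R: "1 \<le> R" and i: "\<lceil>M\<rceil> + 1 \<le> \<bar>i\<bar>" and J: "finite J" "\<And>j. j \<in> J \<Longrightarrow> \<lceil>M\<rceil> + 1 \<le> \<bar>j\<bar>"
    define w where "w j = (min 1 (real_of_int \<bar>i - j\<bar> / R))\<^sup>2" for j
    define g where "g t = ennreal (\<Phi> t * (min 1 ((\<bar>t\<bar> + 1) / R))\<^sup>2)" for t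
    have [measurable]: "g \<in> borel_measurable borel" unfolding g_def[abs_def] by measurable
    have far: "M \<le> \<bar>x\<bar>" if "x \<in> cell l" "\<lceil>M\<rceil> + 1 \<le> \<bar>l\<bar>" for x l
      using cell_far[OF that(1)] that(2) by linarith
    have pointwise: "ennreal (w j) * overlap i j
       \<le> (\<integral>\<^sup>+x. \<integral>\<^sup>+y. g (x - y) * indicator (cell i) x * indicator (cell j) y \<partial>lborel \<partial>lborel)" if j: "j \<in> J" for j
    proof -
      have "ennreal (w j) * overlap i j
        = (\<integral>\<^sup>+x. \<integral>\<^sup>+y. ennreal (w j) * (ennreal ((cmod (K x y))\<^sup>2) * indicator (cell i) x * indicator (cell j) y) \<partial>lborel \<partial>lborel)"
        unfolding overlap_def by (simp add: nn_integral_cmult)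
      also have "\<dots> \<le> (\<integral>\<^sup>+x. \<integral>\<^sup>+y. g (x - y) * indicator (cell i) x * indicator (cell j) y \<partial>lborel \<partial>lborel)"
      proof (intro nn_integral_mono)
        fix x y
        show "ennreal (w j) * (ennreal ((cmod (K x y))\<^sup>2) * indicator (cell i) x * indicator (cell j) y)
          \<le> g (x - y) * indicator (cell i) x * indicator (cell j) y"
        proof (cases "x \<in> cell i \<and> y \<in> cell j")
          case True
          have "w j \<le> (min 1 ((\<bar>x - y\<bar> + 1) / R))\<^sup>2"
            unfolding w_def using True floor_diff_le[of x i y j]
            by (intro power_mono min.mono divide_right_mono) auto
          moreover have "(cmod (K x y))\<^sup>2 \<le> \<Phi> (x - y)"
            using True far[of x i] far[of y j] i J(2)[OF j] by (intro K\<Phi>) auto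
          ultimately have "w j * (cmod (K x y))\<^sup>2 \<le> (min 1 ((\<bar>x - y\<bar> + 1) / R))\<^sup>2 * \<Phi> (x - y)"
            by (intro mult_mono) auto
          then have "ennreal (w j * (cmod (K x y))\<^sup>2) \<le> g (x - y)"
            unfolding g_def by (intro ennreal_leI) (simp add: mult.commute)
          then show ?thesis using True by (simp add: ennreal_mult w_def)
        qed auto
      qed
      finally show ?thesis .
    qed
    have "ennreal (\<Sum>j\<in>J. w j * coupling_weight i j) = (\<Sum>j\<in>J. ennreal (w j) * overlap i j)"
      by (subst sum_ennreal[symmetric])
         (auto simp: w_def coupling_weight_def ennreal_mult ennreal_coupling_weight[unfolded coupling_weight_def])
    also have "\<dots> \<le> (\<Sum>j\<in>J. \<integral>\<^sup>+x. \<integral>\<^sup>+y. g (x - y) * indicator (cell i) x * indicator (cell j) y \<partial>lborel \<partial>lborel)"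
      by (intro sum_mono pointwise)
    also have "\<dots> = (\<integral>\<^sup>+x. \<integral>\<^sup>+y. g (x - y) * indicator (cell i) x * (\<Sum>j\<in>J. indicator (cell j) y) \<partial>lborel \<partial>lborel)"
      by (simp add: nn_integral_sum[symmetric] sum_distrib_left)
    also have "\<dots> \<le> (\<integral>\<^sup>+x. \<integral>\<^sup>+y. g (x - y) * indicator (cell i) x * 1 \<partial>lborel \<partial>lborel)"
      by (intro nn_integral_mono mult_left_mono sum_indicator_cell_le J) simp
    also have "\<dots> = (\<integral>\<^sup>+x. (\<integral>\<^sup>+t. g t \<partial>lborel) * indicator (cell i) x \<partial>lborel)"
    proof (intro nn_integral_cong)
      fix x
      have "(\<integral>\<^sup>+t. g t \<partial>lborel) = (\<integral>\<^sup>+y. g (x - y) \<partial>lborel)"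
        by (subst nn_integral_real_affine[of g "-1" x]) auto
      then show "(\<integral>\<^sup>+y. g (x - y) * indicator (cell i) x * 1 \<partial>lborel) = (\<integral>\<^sup>+t. g t \<partial>lborel) * indicator (cell i) x"
        by (simp add: nn_integral_multc)
    qed
    also have "\<dots> = (\<integral>\<^sup>+t. g t \<partial>lborel) * emeasure lborel (cell i)"
      by (simp add: nn_integral_cmult)
    also have "\<dots> \<le> (\<integral>\<^sup>+t. g t \<partial>lborel) * 1"
      by (intro mult_left_mono emeasure_cell_le) simp
    also have "\<dots> \<le> ennreal (C / R)" using C(2)[of R] R by (simp add: g_def)
    finally show "(\<Sum>j\<in>J. (min 1 (real_of_int \<bar>i - j\<bar> / real R))\<^sup>2 * coupling_weight i j) \<le> C / real R"
      using C(1) R by (subst (asm) ennreal_le_iff) (auto simp: w_def)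
  qed
  then show thesis by (rule that)
qed

end

section \<open>Rigidity of the charge and Palm measures\<close>

text \<open>
  The countable form of convergence, which makes the set of configurations along which a
  sequence converges measurable.
\<close>

lemma tendsto_iff_reciprocals:
  fixes u :: "nat \<Rightarrow> real"
  shows "u \<longlonglongrightarrow> l \<longleftrightarrow> (\<forall>k::nat. \<exists>N. \<forall>n\<ge>N. \<bar>u n - l\<bar> < 1 / Suc k)"
proof
  assume "u \<longlonglongrightarrow> l"
  then show "\<forall>k::nat. \<exists>N. \<forall>n\<ge>N. \<bar>u n - l\<bar> < 1 / Suc k"
    by (auto simp: LIMSEQ_iff)
next
  assume *: "\<forall>k::nat. \<exists>N. \<forall>n\<ge>N. \<bar>u n - l\<bar> < 1 / Suc k"
  show "u \<longlonglongrightarrow> l"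
  proof (rule LIMSEQ_I)
    fix r :: real assume "0 < r"
    then obtain k where "inverse (real (Suc k)) < r" using reals_Archimedean by blast
    then have k: "1 / real (Suc k) < r" by (simp add: inverse_eq_divide)
    obtain N where "\<forall>n\<ge>N. \<bar>u n - l\<bar> < 1 / Suc k" using * by blast
    then show "\<exists>no. \<forall>n\<ge>no. norm (u n - l) < r" using k by (auto intro!: exI[of _ N] elim!: less_trans)
  qed
qed

lemma tendsto_0_if_square_series:
  fixes u :: "nat \<Rightarrow> real"
  assumes "(\<Sum>n. ennreal ((u n)\<^sup>2)) \<noteq> \<infinity>"
  shows "u \<longlonglongrightarrow> 0"
proof -
  have "summable (\<lambda>n. (u n)\<^sup>2)" using assms by (intro summable_suminf_not_top) auto
  then have "(\<lambda>n. (u n)\<^sup>2) \<longlonglongrightarrow> 0" by (rule summable_LIMSEQ_zero)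
  then have "(\<lambda>n. sqrt ((u n)\<^sup>2)) \<longlonglongrightarrow> sqrt 0" by (rule tendsto_real_sqrt)
  then show ?thesis by (simp add: tendsto_rabs_zero_iff)
qed

lemma Conf_finite_cell: "X \<in> Conf \<Longrightarrow> finite (X \<inter> cell i)"
  by (simp add: Conf_def)

lemma card_add_points:
  assumes "finite (X \<inter> B)" "inj_on q {..<m}" "X \<inter> q ` {..<m::nat} = {}"
  shows "card ((X \<union> q ` {..<m}) \<inter> B) = card (X \<inter> B) + (\<Sum>l<m. if q l \<in> B then 1 else 0)"
proof -
  have "(X \<union> q ` {..<m}) \<inter> B = (X \<inter> B) \<union> q ` {l\<in>{..<m}. q l \<in> B}" by auto
  also have "card \<dots> = card (X \<inter> B) + card (q ` {l\<in>{..<m}. q l \<in> B})"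
    using assms by (intro card_Un_disjoint) auto
  also have "card (q ` {l\<in>{..<m}. q l \<in> B}) = card {l\<in>{..<m}. q l \<in> B}"
    using assms(2) by (intro card_image) (auto simp: inj_on_def)
  finally show ?thesis by (simp add: sum.If_cases Collect_conj_eq[symmetric] Int_def lessThan_def)
qed

context J_process
begin

lemma measurable_charge: "(\<lambda>X. charge f X) \<in> borel_measurable conf_space"
proof -
  have [measurable]: "(\<lambda>X. card (X \<inter> cell i)) \<in> measurable conf_space (count_space UNIV)" for i
    by (rule measurable_count) simp_all
  show ?thesis unfolding charge_def count_def by measurable
qed

lemma charge_add_points:
  fixes q :: "nat \<Rightarrow> real" and m :: nat
  assumes "X \<in> Conf" "inj_on q {..<m}" "X \<inter> q ` {..<m} = {}" "\<And>l. l < m \<Longrightarrow> q l \<noteq> 0"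
    and fin: "finite (supp f)"
  shows "charge f (X \<union> q ` {..<m}) = charge f X + (\<Sum>l<m. f \<lfloor>q l\<rfloor> * sgn (q l))"
proof -
  have cnt: "count i (X \<union> q ` {..<m}) = count i X + (\<Sum>l<m. if q l \<in> cell i then 1 else 0)" for i
    unfolding count_def
    by (subst card_add_points[OF Conf_finite_cell[OF assms(1)] assms(2,3)]) (simp add: of_nat_sum if_distrib cong: if_cong)
  have "(\<Sum>i\<in>supp f. f i * side i * (\<Sum>l<m. if q l \<in> cell i then 1 else 0))
      = (\<Sum>l<m. \<Sum>i\<in>supp f. f i * side i * (if q l \<in> cell i then 1 else 0))"
    unfolding sum_distrib_left by (rule sum.swap)
  also have "\<dots> = (\<Sum>l<m. f \<lfloor>q l\<rfloor> * sgn (q l))"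
  proof (intro sum.cong refl)
    fix l assume "l \<in> {..<m}"
    then have c: "q l \<in> cell i \<longleftrightarrow> \<lfloor>q l\<rfloor> = i" for i using assms(4) by (auto simp: cell_iff)
    have "(\<Sum>i\<in>supp f. f i * side i * (if q l \<in> cell i then 1 else 0))
        = (\<Sum>i\<in>supp f. if \<lfloor>q l\<rfloor> = i then f i * side i else 0)"
      by (intro sum.cong refl) (simp add: c)
    also have "\<dots> = f \<lfloor>q l\<rfloor> * side \<lfloor>q l\<rfloor>"
      using fin by (subst sum.delta') auto
    also have "side \<lfloor>q l\<rfloor> = sgn (q l)" using sgn_cell[of "q l" "\<lfloor>q l\<rfloor>"] c by simp
    finally show "(\<Sum>i\<in>supp f. f i * side i * (if q l \<in> cell i then 1 else 0)) = f \<lfloor>q l\<rfloor> * sgn (q l)" .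
  qed
  finally show ?thesis
    unfolding charge_def cnt by (simp add: distrib_left sum.distrib)
qed

text \<open>
  The variances of the charges are summable, so the squared deviations form an almost surely convergent
  series.
\<close>

lemma charge_rigidity:
  assumes dec: "decay_condition K"
  obtains f where "\<And>n. finite (supp (f n))" "\<And>i. (\<lambda>n. f n i) \<longlonglongrightarrow> 1"
    "AE X in P. (\<lambda>n. charge (f n) X - mean_charge (f n)) \<longlonglongrightarrow> 0"
proof -
  obtain M C where MC: "decaying_coupling coupling_weight mass M C"
    using coupling_decays[OF dec] .
  interpret decaying_coupling coupling_weight mass M C by (rule MC)
  obtain f where f: "\<And>n. finite (supp (f n))" "\<And>n. form (f n) (f n) \<le> (1/2) ^ n"
    "\<And>n i. 1 - \<bar>i\<bar> / Suc n \<le> f n i" "\<And>n i. f n i \<le> 1"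
    using cheap_cutoffs by blast
  have lim: "(\<lambda>n. f n i) \<longlonglongrightarrow> 1" for i
  proof (rule tendsto_sandwich[OF _ _ _ tendsto_const])
    have "(\<lambda>n. real_of_int \<bar>i\<bar> / real (Suc n)) \<longlonglongrightarrow> 0"
      by (rule LIMSEQ_Suc) (rule lim_const_over_n)
    then have "(\<lambda>n. 1 - real_of_int \<bar>i\<bar> / real (Suc n)) \<longlonglongrightarrow> 1 - 0" by (intro tendsto_intros)
    then show "(\<lambda>n. 1 - real_of_int \<bar>i\<bar> / real (Suc n)) \<longlonglongrightarrow> 1" by simp
    show "\<forall>\<^sub>F n in sequentially. 1 - real_of_int \<bar>i\<bar> / real (Suc n) \<le> f n i"
      using f(3) by (intro always_eventually allI) simp
    show "\<forall>\<^sub>F n in sequentially. f n i \<le> 1"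
      by (intro always_eventually allI f(4))
  qed
  have [measurable]: "charge g \<in> borel_measurable P" for g
    unfolding charge_def[abs_def] by measurable
  have "(\<integral>\<^sup>+X. (\<Sum>n. ennreal ((charge (f n) X - mean_charge (f n))\<^sup>2)) \<partial>P)
     = (\<Sum>n. \<integral>\<^sup>+X. ennreal ((charge (f n) X - mean_charge (f n))\<^sup>2) \<partial>P)"
    by (rule nn_integral_suminf) measurable
  also have "\<dots> \<le> (\<Sum>n. ennreal ((1/2) ^ n))"
    by (intro suminf_le order_trans[OF charge_variance[OF f(1)] ennreal_leI[OF f(2)]]) auto
  also have "\<dots> < \<infinity>"
    by (subst suminf_ennreal2) (auto intro!: summable_geometric)
  finally have "AE X in P. (\<Sum>n. ennreal ((charge (f n) X - mean_charge (f n))\<^sup>2)) \<noteq> \<infinity>"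
    by (intro nn_integral_PInf_AE) auto
  then have "AE X in P. (\<lambda>n. charge (f n) X - mean_charge (f n)) \<longlonglongrightarrow> 0"
    by eventually_elim (rule tendsto_0_if_square_series)
  with f(1) lim show thesis by (rule that)
qed

text \<open>
  In the Palm identity take for \<open>u\<close> the indicator of the configurations along which the centred charge
  does not tend to 0.  The left-hand side vanishes, hence under the reduced Palm measure the centred charge
  of \<open>X \<union> q ` {..<m}\<close> tends to 0.  The added points change it by the cutoff values at \<open>q\<close> times
  their signs, and the cutoffs tend to 1.
\<close>

lemma palm_charge_shift:
  assumes f: "\<And>n. finite (supp (f n))" "\<And>i. (\<lambda>n. f n i) \<longlonglongrightarrow> 1"
    and rigid: "AE X in P. (\<lambda>n. charge (f n) X - mean_charge (f n)) \<longlonglongrightarrow> 0"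
    and palm: "reduced_palm P m \<rho> Q" and sets_\<rho>: "sets \<rho> = sets (PiM {..<m} (\<lambda>_. borel))"
  shows "AE q in \<rho>. inj_on q {..<m} \<longrightarrow> (\<forall>l<m. q l \<noteq> 0) \<longrightarrow>
    (AE X in Q q. (\<lambda>n. charge (f n) X - mean_charge (f n)) \<longlonglongrightarrow> - (\<Sum>l<m. sgn (q l)))"
proof -
  define dev where "dev X n = charge (f n) X - mean_charge (f n)" for X n
  let ?q = "PiM {..<m} (\<lambda>_. borel :: real measure)"
  have [measurable]: "(\<lambda>X. dev X n) \<in> borel_measurable conf_space" for n
    unfolding dev_def by (intro borel_measurable_diff measurable_charge) simp
  have Q: "Q \<in> measurable \<rho> (prob_algebra conf_space)"
    and disj: "AE q in \<rho>. AE X in Q q. X \<inter> q ` {..<m} = {}"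
    and campbell: "\<And>u :: real set \<times> (nat \<Rightarrow> real) \<Rightarrow> ennreal. u \<in> borel_measurable (conf_space \<Otimes>\<^sub>M ?q) \<Longrightarrow>
        (\<integral>\<^sup>+X. (\<integral>\<^sup>+q. u (X, q) \<partial>count_space (distinct_tuples m X)) \<partial>P) =
        (\<integral>\<^sup>+q. (\<integral>\<^sup>+X. u (X \<union> q ` {..<m}, q) \<partial>Q q) \<partial>\<rho>)"
    using palm unfolding reduced_palm_def by blast+
  have Qsub: "Q \<in> measurable \<rho> (subprob_algebra conf_space)" using Q by (rule measurable_prob_algebraD)
  have sets_Q: "sets (Q q) = sets conf_space" and space_Q: "space (Q q) = Conf" if "q \<in> space \<rho>" for q
  proof -
    show "sets (Q q) = sets conf_space" using sets_kernel[OF Qsub that] .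
    then show "space (Q q) = Conf" using sets_eq_imp_space_eq space_conf_space by metis
  qed
  define bad where "bad X s \<longleftrightarrow> \<not> dev X \<longlonglongrightarrow> s" for X s
  \<comment> \<open>\<open>v\<close> describes the same event through \<open>X\<close> and \<open>q\<close> separately.  It is jointly measurable by
      construction, so joint measurability of \<open>(X, q) \<mapsto> X \<union> q ` {..<m}\<close> can be bypassed.\<close>
  define u :: "real set \<times> (nat \<Rightarrow> real) \<Rightarrow> ennreal" where "u = (\<lambda>(X, q). indicator {X. bad X 0} X)"
  define v :: "(nat \<Rightarrow> real) \<Rightarrow> real set \<Rightarrow> ennreal" where
    "v q X = (if inj_on q {..<m} \<and> (\<forall>l<m. q l \<noteq> 0) \<and> bad X (- (\<Sum>l<m. sgn (q l))) then 1 else 0)" for q X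
  have coord [measurable]: "(\<lambda>q. q l) \<in> borel_measurable ?q" if "l < m" for l
    using that by simp
  have [measurable]: "(\<lambda>q. \<Sum>l<m. sgn (q l)) \<in> borel_measurable ?q"
    unfolding sgn_real_def by (intro borel_measurable_sum) measurable
  have [measurable]: "Measurable.pred conf_space (\<lambda>X. bad X 0)"
    unfolding bad_def tendsto_iff_reciprocals by measurable
  have [measurable]: "Measurable.pred ?q (\<lambda>q. inj_on q {..<m})"
  proof -
    have "Measurable.pred ?q (\<lambda>q. \<forall>i\<in>{..<m}. \<forall>j\<in>{..<m}. q i = q j \<longrightarrow> i = j)"
    proof (intro pred_intros_finite)
      fix i j assume "i \<in> {..<m}" "j \<in> {..<m}"
      then have [measurable]: "(\<lambda>q. q i) \<in> borel_measurable ?q" "(\<lambda>q. q j) \<in> borel_measurable ?q" by simp_all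
      have eq: "Measurable.pred ?q (\<lambda>q. q i = q j)"
        unfolding pred_def by (rule borel_measurable_eq) measurable
      show "Measurable.pred ?q (\<lambda>q. q i = q j \<longrightarrow> i = j)"
        by (intro pred_intros_logic eq) simp
    qed simp_all
    then show ?thesis
      unfolding inj_on_def .
  qed
  have u_meas: "u \<in> borel_measurable (conf_space \<Otimes>\<^sub>M ?q)"
    unfolding u_def by measurable
  have v_meas_pair: "case_prod v \<in> borel_measurable (?q \<Otimes>\<^sub>M conf_space)"
    unfolding v_def bad_def tendsto_iff_reciprocals by measurable
  then have v_meas: "case_prod v \<in> borel_measurable (\<rho> \<Otimes>\<^sub>M conf_space)"
    by (subst measurable_cong_sets[OF sets_pair_measure_cong[OF sets_\<rho> refl] refl])
  have "AE X in P. (\<integral>\<^sup>+q. u (X, q) \<partial>count_space (distinct_tuples m X)) = 0"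
    using rigid by eventually_elim (simp add: u_def bad_def dev_def[abs_def])
  then have "(\<integral>\<^sup>+X. (\<integral>\<^sup>+q. u (X, q) \<partial>count_space (distinct_tuples m X)) \<partial>P) = (\<integral>\<^sup>+X. 0 \<partial>P)"
    by (rule nn_integral_cong_AE)
  then have zero: "(\<integral>\<^sup>+q. (\<integral>\<^sup>+X. u (X \<union> q ` {..<m}, q) \<partial>Q q) \<partial>\<rho>) = 0"
    using campbell[OF u_meas] by simp
  have "(\<integral>\<^sup>+q. (\<integral>\<^sup>+X. v q X \<partial>Q q) \<partial>\<rho>)
      \<le> (\<integral>\<^sup>+q. (\<integral>\<^sup>+X. u (X \<union> q ` {..<m}, q) \<partial>Q q) \<partial>\<rho>)"
  proof (rule nn_integral_mono_AE)
    show "AE q in \<rho>. (\<integral>\<^sup>+X. v q X \<partial>Q q) \<le> (\<integral>\<^sup>+X. u (X \<union> q ` {..<m}, q) \<partial>Q q)"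
      using disj AE_space[of \<rho>]
    proof eventually_elim
      case (elim q)
      show ?case
      proof (rule nn_integral_mono_AE)
        show "AE X in Q q. v q X \<le> u (X \<union> q ` {..<m}, q)"
          using elim(1) AE_space[of "Q q"]
        proof eventually_elim
          case (elim X)
          then have X: "X \<in> Conf" using space_Q \<open>q \<in> space \<rho>\<close> by simp
          show ?case
          proof (cases "inj_on q {..<m} \<and> (\<forall>l<m. q l \<noteq> 0) \<and> dev (X \<union> q ` {..<m}) \<longlonglongrightarrow> 0")
            case True
            then have "dev (X \<union> q ` {..<m}) n = dev X n + (\<Sum>l<m. f n \<lfloor>q l\<rfloor> * sgn (q l))" for n
              using charge_add_points[OF X _ elim(1) _ f(1)] by (simp add: dev_def)
            then have "dev X = (\<lambda>n. dev (X \<union> q ` {..<m}) n - (\<Sum>l<m. f n \<lfloor>q l\<rfloor> * sgn (q l)))"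
              by (intro ext) simp
            also have "\<dots> \<longlonglongrightarrow> 0 - (\<Sum>l<m. 1 * sgn (q l))"
              using True by (intro tendsto_intros f(2)) auto
            finally have "\<not> bad X (- (\<Sum>l<m. sgn (q l)))" by (simp add: bad_def)
            then show ?thesis by (simp add: v_def)
          next
            case False
            then show ?thesis by (auto simp: v_def u_def bad_def)
          qed
        qed
      qed
    qed
  qed
  then have z: "(\<integral>\<^sup>+q. (\<integral>\<^sup>+X. v q X \<partial>Q q) \<partial>\<rho>) = 0"
    using zero by simp
  have "(\<lambda>q. \<integral>\<^sup>+X. v q X \<partial>Q q) \<in> borel_measurable \<rho>"
    by (rule nn_integral_measurable_subprob_algebra2[OF v_meas Qsub])
  then have "AE q in \<rho>. (\<integral>\<^sup>+X. v q X \<partial>Q q) = 0"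
    using z by (subst (asm) nn_integral_0_iff_AE)
  then show ?thesis
    using AE_space[of \<rho>]
  proof eventually_elim
    case (elim q)
    show ?case
    proof (intro impI)
      assume q: "inj_on q {..<m}" "\<forall>l<m. q l \<noteq> 0"
      have "v q \<in> borel_measurable conf_space"
        using measurable_compose[OF measurable_Pair1'[OF elim(2)] v_meas] by simp
      then have "v q \<in> borel_measurable (Q q)"
        using measurable_cong_sets[OF sets_Q[OF elim(2)] refl] by blast
      moreover have "(\<integral>\<^sup>+X. v q X \<partial>Q q) = 0" using elim(1) q by simp
      ultimately have "AE X in Q q. v q X = 0" by (simp add: nn_integral_0_iff_AE)
      then show "AE X in Q q. (\<lambda>n. charge (f n) X - mean_charge (f n)) \<longlonglongrightarrow> - (\<Sum>l<m. sgn (q l))"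
        by eventually_elim (use q in \<open>auto simp: v_def bad_def dev_def[abs_def] split: if_splits\<close>)
    qed
  qed
qed

end

theorem corollary1p5:
  fixes K :: "real \<Rightarrow> real \<Rightarrow> complex"
    and P :: "real set measure"
    and n k :: nat
    and Q :: "(nat \<Rightarrow> real) \<Rightarrow> real set measure"
  assumes "J_hermitian K"
    and "lytvynov_condition K"
    and "diagonal_gives_traces K"
    and "decay_condition K"
    and "determinantal K P"
    and "n \<noteq> k"
    and "reduced_palm P (n + k) (det_measure K (n + k)) Q"
  shows "AE p in det_measure K (n + k).
           inj_on p {..<n + k} \<longrightarrow> (\<forall>i\<in>{..<n}. 0 < p i) \<longrightarrow> (\<forall>i\<in>{n..<n + k}. p i < 0) \<longrightarrow>
             mutually_singular (Q p) P"
proof -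
  interpret J_process K P using assms by unfold_locales
  define m where "m = n + k"
  have palm: "reduced_palm P m (det_measure K m) Q" using assms by (simp add: m_def)
  have sets_det: "sets (det_measure K m) = sets (PiM {..<m} (\<lambda>_. borel))"
    unfolding det_measure_def sets_density by (intro sets_PiM_cong refl) simp
  have Q_kernel: "Q \<in> measurable (det_measure K m) (prob_algebra conf_space)"
    using palm unfolding reduced_palm_def by blast
  obtain f where f: "\<And>j. finite (supp (f j))" "\<And>i. (\<lambda>j. f j i) \<longlonglongrightarrow> 1"
    "AE X in P. (\<lambda>j. charge (f j) X - mean_charge (f j)) \<longlonglongrightarrow> 0"
    using charge_rigidity[OF \<open>decay_condition K\<close>] by blast
  define A where "A = {X \<in> space conf_space. (\<lambda>j. charge (f j) X - mean_charge (f j)) \<longlonglongrightarrow> 0}"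
  have A: "A \<in> sets conf_space"
  proof -
    have [measurable]: "(\<lambda>X. charge (f j) X) \<in> borel_measurable conf_space" for j by (rule measurable_charge)
    show ?thesis unfolding A_def tendsto_iff_reciprocals by measurable
  qed
  have sets_P: "sets P = sets conf_space" using process by (simp add: point_process_def)
  have PA: "emeasure P (space P - A) = 0"
  proof -
    have "AE X in P. X \<in> A"
      using f(3) AE_space by eventually_elim (use sets_eq_imp_space_eq[OF sets_P] in \<open>auto simp: A_def\<close>)
    then show ?thesis using A sets_P by (subst (asm) AE_iff_measurable[where N = "space P - A"]) auto
  qed
  have "AE p in det_measure K m. inj_on p {..<m} \<longrightarrow> (\<forall>i\<in>{..<n}. 0 < p i) \<longrightarrow> (\<forall>i\<in>{n..<m}. p i < 0) \<longrightarrow>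
     mutually_singular (Q p) P"
    using palm_charge_shift[OF f palm sets_det] AE_space
  proof eventually_elim
    case (elim p)
    show ?case
    proof (intro impI)
      assume inj: "inj_on p {..<m}" and pos: "\<forall>i\<in>{..<n}. 0 < p i" and neg: "\<forall>i\<in>{n..<m}. p i < 0"
      have nz: "\<forall>l<m. p l \<noteq> 0"
        using pos neg by (metis atLeastLessThan_iff lessThan_iff less_irrefl not_le_imp_less)
      have "(\<Sum>l<m. sgn (p l)) = (\<Sum>l\<in>{..<n}. sgn (p l)) + (\<Sum>l\<in>{n..<m}. sgn (p l))"
        unfolding m_def by (subst sum.union_disjoint[symmetric]) (auto intro!: sum.cong)
      also have "\<dots> = real n - real k" using pos neg by (simp add: m_def)
      finally have charge: "- (\<Sum>l<m. sgn (p l)) \<noteq> 0" using \<open>n \<noteq> k\<close> by simp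
      have "AE X in Q p. X \<notin> A"
      proof -
        have "AE X in Q p. (\<lambda>j. charge (f j) X - mean_charge (f j)) \<longlonglongrightarrow> - (\<Sum>l<m. sgn (p l))"
          using elim(1) inj nz by blast
        then show ?thesis
        proof eventually_elim
          case (elim X)
          show "X \<notin> A"
          proof
            assume "X \<in> A"
            then have "(\<lambda>j. charge (f j) X - mean_charge (f j)) \<longlonglongrightarrow> 0" by (simp add: A_def)
            then show False using LIMSEQ_unique[OF elim] charge by simp
          qed
        qed
      qed
      moreover have sets_Q: "sets (Q p) = sets conf_space"
        by (rule sets_kernel[OF measurable_prob_algebraD[OF Q_kernel] elim(2)])
      ultimately have "emeasure (Q p) A = 0"
        using A sets.sets_into_space[OF A] sets_eq_imp_space_eq[OF sets_Q]
        by (subst (asm) AE_iff_measurable[where N = A]) auto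
      then show "mutually_singular (Q p) P"
        unfolding mutually_singular_def using PA A sets_P sets_Q by auto
    qed
  qed
  then show ?thesis by (simp only: m_def)
qed

end
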